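(* Let $n\ge 2$. For $1\le k\le n-2$, the restriction $\mathrm{Res}^{A_n}_{A_{n-1}}\mathrm{C}_0(\Lambda^kV_n)$ of the irreducible calibrated $A_n$-representation $\mathrm{C}_0(\Lambda^kV_n)$ is indecomposable, and there is a non-split short exact sequence of calibrated $A_{n-1}$-representations $$0\to\mathrm{C}_0(\Lambda^kV_{n-1})\to\mathrm{Res}^{A_n}_{A_{n-1}}\mathrm{C}_0(\Lambda^kV_n)\to\mathrm{C}_0(\Lambda^{k-1}V_{n-1})\to 0.$$ For the extremal cases $k=0$ and $k=n-1$ we have $\mathrm{Res}^{A_n}_{A_{n-1}}\mathrm{C}_0(\Lambda^0V_n)\cong\mathrm{C}_0(\Lambda^0V_{n-1})$ and $\mathrm{Res}^{A_n}_{A_{n-1}}\mathrm{C}_0(\Lambda^{n-1}V_n)\cong\mathrm{C}_0(\Lambda^{n-2}V_{n-1})$.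
   Context: The periplectic Brauer algebra $A_n$ is the unital associative $\mathbb{C}$-algebra with generators $s_i,e_i$ ($1\le i\le n-1$) and relations (for all indices for which the expressions make sense): $s_i^2=1$; $s_is_j=s_js_i$, $s_ie_j=e_js_i$, $e_ie_j=e_je_i$ if $|i-j|>1$; $s_is_{i+1}s_i=s_{i+1}s_is_{i+1}$; $e_{i+1}e_ie_{i+1}=-e_{i+1}$; $e_ie_{i+1}e_i=-e_i$; $e_is_i=e_i$; $s_ie_i=-e_i$; $s_ie_{i+1}e_i=s_{i+1}e_i$; $s_{i+1}e_ie_{i+1}=-s_ie_{i+1}$; $e_{i+1}e_is_{i+1}=e_{i+1}s_i$; $e_ie_{i+1}s_i=-e_is_{i+1}$; $e_i^2=0$. In particular $A_1=\mathbb{C}$. The algebra $A_{n-1}$ is embedded in $A_n$ as the subalgebra generated by $s_1,\dots,s_{n-2},e_1,\dots,e_{n-2}$. The Jucys--Murphy elements of $A_n$ are $Y_1:=0$, $Y_{j+1}:=s_jY_js_j+s_j+e_j$ for $1\le j\le n-1$. A representation of $A_n$ is calibrated if it has a basis with respect to which all $Y_j$, $1\le j\le n$, act by diagonal matrices. For $n\ge 1$ and $0\le k\le n-1$, $\mathrm{C}_0(\Lambda^kV_n)$ is the following $A_n$-representation of dimension $\binom{n-1}{k}$ (its underlying $S_n$-representation is the $k$-th exterior power $\Lambda^kV_n$ of the standard representation $V_n$ of $S_n$). It has basis $v_S=\overline v_{a_1}\wedge\dots\wedge\overline v_{a_k}$ indexed by $k$-element subsets $S=\{a_1<\dots<a_k\}\subseteq\{1,\dots,n-1\}$.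 If $i\in S$, then $s_iv_S=-v_S$ and $e_iv_S=0$. If $i\notin S$, then $$s_iv_S=v_S-[i+1\in S]\,v_{(S\setminus\{i+1\})\cup\{i\}}-[i-1\in S]\,v_{(S\setminus\{i-1\})\cup\{i\}},$$ $$e_iv_S=[i+1\in S]\,v_{(S\setminus\{i+1\})\cup\{i\}}-[i-1\in S]\,v_{(S\setminus\{i-1\})\cup\{i\}},$$ where $[P]=1$ if $P$ holds and $[P]=0$ otherwise. The elements $Y_j$ act diagonally in this basis: $Y_{j+1}$ acts by the sum of the diagonal parts of the matrices of $s_1,\dots,s_j$. This representation is irreducible and calibrated. For $k=0$ and $k=n-1$ it is the trivial, respectively sign, representation of $S_n$ with every $e_i$ acting by $0$. *)

theory Defs
  imports
    Complex_Main
    "HOL-Library.Poly_Mapping"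
    "HOL-Algebra.QuotRing"
    "HOL-Algebra.Module"
    "Jordan_Normal_Form.VS_Connect"
begin

section \<open>The periplectic Brauer algebra\<close>

datatype generator = Sgen nat | Egen nat

text \<open>Words are the free monoid on the generators. It is written additively so that
  finitely supported functions on words form its monoid algebra over the complex numbers,
  i.e. the free associative unital algebra.\<close>

datatype gen_word = Word (letters: "generator list")

instantiation gen_word :: monoid_add
begin

definition zero_gen_word :: gen_word
  where "0 = Word []"

definition plus_gen_word :: "gen_word \<Rightarrow> gen_word \<Rightarrow> gen_word"
  where "u + v = Word (letters u @ letters v)"

instance
  by standard (simp_all add: zero_gen_word_def plus_gen_word_def)

end

type_synonym free_elem = "gen_word \<Rightarrow>\<^sub>0 complex"

definition gens :: "nat \<Rightarrow> generator set"
  where "gens n = Sgen ` {1..<n} \<union> Egen ` {1..<n}"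

definition free_alg :: "nat \<Rightarrow> free_elem ring"
  where "free_alg n =
    \<lparr>carrier = {f. \<forall>w \<in> Poly_Mapping.keys f. set (letters w) \<subseteq> gens n},
     mult = (*), one = 1, zero = 0, add = (+)\<rparr>"

definition fs :: "nat \<Rightarrow> free_elem"
  where "fs i = Poly_Mapping.single (Word [Sgen i]) 1"

definition fe :: "nat \<Rightarrow> free_elem"
  where "fe i = Poly_Mapping.single (Word [Egen i]) 1"

text \<open>A defining relation \<open>x = y\<close> is recorded as the element \<open>x - y\<close>.\<close>

definition relations :: "nat \<Rightarrow> free_elem set"
  where "relations n =
    (\<Union>i\<in>{1..<n}.
      {fs i * fs i - 1,
       fe i * fs i - fe i,
       fs i * fe i + fe i,
       fe i * fe i}) \<union>
    (\<Union>i\<in>{1..<n}. \<Union>j\<in>{j\<in>{1..<n}. i + 1 < j \<or> j + 1 < i}.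
      {fs i * fs j - fs j * fs i,
       fs i * fe j - fe j * fs i,
       fe i * fe j - fe j * fe i}) \<union>
    (\<Union>i\<in>{i. 1 \<le> i \<and> i + 1 < n}.
      {fs i * fs (i+1) * fs i - fs (i+1) * fs i * fs (i+1),
       fe (i+1) * fe i * fe (i+1) + fe (i+1),
       fe i * fe (i+1) * fe i + fe i,
       fs i * fe (i+1) * fe i - fs (i+1) * fe i,
       fs (i+1) * fe i * fe (i+1) + fs i * fe (i+1),
       fe (i+1) * fe i * fs (i+1) - fe (i+1) * fs i,
       fe i * fe (i+1) * fs i + fe i * fs (i+1)})"

definition rel_ideal :: "nat \<Rightarrow> free_elem set"
  where "rel_ideal n = Idl\<^bsub>free_alg n\<^esub> (relations n)"

definition pbrauer :: "nat \<Rightarrow> free_elem set ring"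
  where "pbrauer n = free_alg n Quot rel_ideal n"

definition quot_class :: "nat \<Rightarrow> free_elem \<Rightarrow> free_elem set"
  where "quot_class n f = rel_ideal n +>\<^bsub>free_alg n\<^esub> f"

definition pscalar :: "nat \<Rightarrow> complex \<Rightarrow> free_elem set"
  where "pscalar n c = quot_class n (Poly_Mapping.single 0 c)"

text \<open>The canonical homomorphism \<open>A\<^sub>m \<rightarrow> A\<^sub>n\<close> for \<open>m \<le> n\<close>, sending each generator to the
  generator of the same name; all representatives of a coset have the same image.\<close>

definition pembed :: "nat \<Rightarrow> nat \<Rightarrow> free_elem set \<Rightarrow> free_elem set"
  where "pembed m n a = the_elem (quot_class n ` a)"

text \<open>The Jucys--Murphy element \<open>Y\<^sub>j\<close> is \<open>jucys_murphy n j\<close> for \<open>1 \<le> j \<le> n\<close>; the value at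
  \<open>j = 0\<close> is a dummy.\<close>

fun jucys_murphy :: "nat \<Rightarrow> nat \<Rightarrow> free_elem set"
  where
    "jucys_murphy n 0 = \<zero>\<^bsub>pbrauer n\<^esub>"
  | "jucys_murphy n (Suc 0) = \<zero>\<^bsub>pbrauer n\<^esub>"
  | "jucys_murphy n (Suc (Suc j)) =
      quot_class n (fs (Suc j)) \<otimes>\<^bsub>pbrauer n\<^esub> jucys_murphy n (Suc j)
          \<otimes>\<^bsub>pbrauer n\<^esub> quot_class n (fs (Suc j))
        \<oplus>\<^bsub>pbrauer n\<^esub> quot_class n (fs (Suc j))
        \<oplus>\<^bsub>pbrauer n\<^esub> quot_class n (fe (Suc j))"


section \<open>Modules over a not necessarily commutative ring\<close>

text \<open>The axioms of \<^locale>\<open>module\<close> without commutativity of the ring. A representation of a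
  complex algebra is a left module over it; its complex vector space structure comes from
  the scalars in the algebra.\<close>

locale left_module = R?: ring R + M?: abelian_group M
    for R :: "('a, 'r) ring_scheme" and M :: "('a, 'v, 'm) module_scheme" (structure) +
  assumes smult_closed:
      "\<lbrakk>a \<in> carrier R; x \<in> carrier M\<rbrakk> \<Longrightarrow> a \<odot>\<^bsub>M\<^esub> x \<in> carrier M"
    and smult_l_distr:
      "\<lbrakk>a \<in> carrier R; b \<in> carrier R; x \<in> carrier M\<rbrakk> \<Longrightarrow>
        (a \<oplus>\<^bsub>R\<^esub> b) \<odot>\<^bsub>M\<^esub> x = a \<odot>\<^bsub>M\<^esub> x \<oplus>\<^bsub>M\<^esub> b \<odot>\<^bsub>M\<^esub> x"
    and smult_r_distr:
      "\<lbrakk>a \<in> carrier R; x \<in> carrier M; y \<in> carrier M\<rbrakk> \<Longrightarrow>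
        a \<odot>\<^bsub>M\<^esub> (x \<oplus>\<^bsub>M\<^esub> y) = a \<odot>\<^bsub>M\<^esub> x \<oplus>\<^bsub>M\<^esub> a \<odot>\<^bsub>M\<^esub> y"
    and smult_assoc1:
      "\<lbrakk>a \<in> carrier R; b \<in> carrier R; x \<in> carrier M\<rbrakk> \<Longrightarrow>
        (a \<otimes>\<^bsub>R\<^esub> b) \<odot>\<^bsub>M\<^esub> x = a \<odot>\<^bsub>M\<^esub> (b \<odot>\<^bsub>M\<^esub> x)"
    and smult_one:
      "x \<in> carrier M \<Longrightarrow> \<one>\<^bsub>R\<^esub> \<odot>\<^bsub>M\<^esub> x = x"

definition irreducible_mod :: "'a ring \<Rightarrow> ('a, 'v) module \<Rightarrow> bool"
  where "irreducible_mod R M \<longleftrightarrow>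
    left_module R M \<and> carrier M \<noteq> {\<zero>\<^bsub>M\<^esub>} \<and>
    (\<forall>N. Module.submodule N R M \<longrightarrow> N = {\<zero>\<^bsub>M\<^esub>} \<or> N = carrier M)"

definition indecomposable_mod :: "'a ring \<Rightarrow> ('a, 'v) module \<Rightarrow> bool"
  where "indecomposable_mod R M \<longleftrightarrow>
    left_module R M \<and> carrier M \<noteq> {\<zero>\<^bsub>M\<^esub>} \<and>
    (\<forall>N1 N2. Module.submodule N1 R M \<longrightarrow> Module.submodule N2 R M \<longrightarrow>
      N1 <+>\<^bsub>M\<^esub> N2 = carrier M \<longrightarrow> N1 \<inter> N2 = {\<zero>\<^bsub>M\<^esub>} \<longrightarrow>
      N1 = {\<zero>\<^bsub>M\<^esub>} \<or> N2 = {\<zero>\<^bsub>M\<^esub>})"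

definition isomorphic_mod :: "'a ring \<Rightarrow> ('a, 'v) module \<Rightarrow> ('a, 'w) module \<Rightarrow> bool"
  where "isomorphic_mod R M N \<longleftrightarrow>
    left_module R M \<and> left_module R N \<and>
    (\<exists>f \<in> LinearCombinations.module_hom R M N. bij_betw f (carrier M) (carrier N))"

definition short_exact ::
    "'a ring \<Rightarrow> ('a, 'u) module \<Rightarrow> ('a, 'v) module \<Rightarrow> ('a, 'w) module \<Rightarrow>
      ('u \<Rightarrow> 'v) \<Rightarrow> ('v \<Rightarrow> 'w) \<Rightarrow> bool"
  where "short_exact R L M N f g \<longleftrightarrow>
    left_module R L \<and> left_module R M \<and> left_module R N \<and>
    f \<in> LinearCombinations.module_hom R L M \<and> g \<in> LinearCombinations.module_hom R M N \<and>
    inj_on f (carrier L) \<and>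
    f ` carrier L = {x \<in> carrier M. g x = \<zero>\<^bsub>N\<^esub>} \<and>
    g ` carrier M = carrier N"

definition split_epi :: "'a ring \<Rightarrow> ('a, 'v) module \<Rightarrow> ('a, 'w) module \<Rightarrow> ('v \<Rightarrow> 'w) \<Rightarrow> bool"
  where "split_epi R M N g \<longleftrightarrow>
    (\<exists>s \<in> LinearCombinations.module_hom R N M. \<forall>x \<in> carrier N. g (s x) = x)"

definition restrict_scalars :: "('b \<Rightarrow> 'a) \<Rightarrow> ('a, 'v) module \<Rightarrow> ('b, 'v) module"
  where "restrict_scalars \<phi> M =
    \<lparr>carrier = carrier M, mult = mult M, one = one M, zero = zero M, add = add M,
     smult = (\<lambda>b. smult M (\<phi> b))\<rparr>"


section \<open>Representations of the periplectic Brauer algebra\<close>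

definition complex_space ::
    "nat \<Rightarrow> (free_elem set, 'v) module \<Rightarrow> (complex, 'v) module"
  where "complex_space n M = restrict_scalars (pscalar n) M"

definition calibrated :: "nat \<Rightarrow> (free_elem set, 'v) module \<Rightarrow> bool"
  where "calibrated n M \<longleftrightarrow>
    left_module (pbrauer n) M \<and>
    (\<exists>B. vectorspace.basis class_ring (complex_space n M) B \<and>
      (\<forall>b\<in>B. \<forall>j\<in>{1..n}. \<exists>c.
        jucys_murphy n j \<odot>\<^bsub>M\<^esub> b = c \<odot>\<^bsub>complex_space n M\<^esub> b))"

text \<open>Restriction from \<open>A\<^sub>n\<close> to \<open>A\<^sub>m\<close>, for \<open>m \<le> n\<close>.\<close>

definition Res :: "nat \<Rightarrow> nat \<Rightarrow> (free_elem set, 'v) module \<Rightarrow> (free_elem set, 'v) module"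
  where "Res n m M = restrict_scalars (pembed m n) M"


section \<open>The representations on exterior powers of the standard representation\<close>

text \<open>A vector is a finitely supported function on sets of natural numbers; \<open>bvec S\<close> is the
  basis vector \<open>v\<^sub>S\<close>.\<close>

type_synonym ext_vec = "nat set \<Rightarrow>\<^sub>0 complex"

definition cscale :: "complex \<Rightarrow> ext_vec \<Rightarrow> ext_vec"
  where "cscale c v = Poly_Mapping.map ((*) c) v"

definition bvec :: "nat set \<Rightarrow> ext_vec"
  where "bvec S = Poly_Mapping.single S 1"

text \<open>For \<open>i = 1\<close> the index \<open>i - 1 = 0\<close> never lies in \<open>S\<close>, since only subsets of \<open>{1..<n}\<close> are used.\<close>

fun gen_on_basis :: "generator \<Rightarrow> nat set \<Rightarrow> ext_vec"
  where
    "gen_on_basis (Sgen i) S =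
      (if i \<in> S then - bvec S
       else bvec S
          - (if i + 1 \<in> S then bvec ((S - {i + 1}) \<union> {i}) else 0)
          - (if i - 1 \<in> S then bvec ((S - {i - 1}) \<union> {i}) else 0))"
  | "gen_on_basis (Egen i) S =
      (if i \<in> S then 0
       else (if i + 1 \<in> S then bvec ((S - {i + 1}) \<union> {i}) else 0)
          - (if i - 1 \<in> S then bvec ((S - {i - 1}) \<union> {i}) else 0))"

definition gen_act :: "generator \<Rightarrow> ext_vec \<Rightarrow> ext_vec"
  where "gen_act x v =
    (\<Sum>S\<in>Poly_Mapping.keys v. cscale (Poly_Mapping.lookup v S) (gen_on_basis x S))"

definition free_act :: "free_elem \<Rightarrow> ext_vec \<Rightarrow> ext_vec"
  where "free_act f v =
    (\<Sum>w\<in>Poly_Mapping.keys f. cscale (Poly_Mapping.lookup f w) (foldr gen_act (letters w) v))"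

text \<open>\<open>C0 n k\<close> is the representation \<open>C\<^sub>0(\<Lambda>\<^sup>k V\<^sub>n)\<close> of \<open>A\<^sub>n\<close>. A coset acts through any of its
  representatives, which all act in the same way because the defining relations hold for the
  operators above. The ring multiplication and unit, part of the record type of modules, are
  dummies.\<close>

definition C0 :: "nat \<Rightarrow> nat \<Rightarrow> (free_elem set, ext_vec) module"
  where "C0 n k =
    \<lparr>carrier = {v. Poly_Mapping.keys v \<subseteq> {S. S \<subseteq> {1..<n} \<and> card S = k}},
     mult = (\<lambda>_ _. 0), one = 0, zero = 0, add = (+),
     smult = (\<lambda>a v. the_elem ((\<lambda>f. free_act f v) ` a))\<rparr>"

end

theory Submission
  imports Defs
begin

text \<open>Think of a basis vector \<open>v\<^sub>S\<close> as particles on the sites \<open>S\<close>; up to diagonal terms, \<open>s\<^sub>i\<close> and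
  \<open>e\<^sub>i\<close> move a particle from a neighbouring site to the empty site \<open>i\<close>. The Jucys--Murphy elements
  act diagonally, and their joint eigenvalues determine \<open>S\<close>, even when only \<open>Y\<^sub>1, \<dots>, Y\<^sub>n\<^sub>-\<^sub>1\<close> are used
  on \<open>C\<^sub>0(\<Lambda>\<^sup>k V\<^sub>n)\<close>, because the number of particles is fixed. Hence every submodule is spanned by
  basis vectors. Moving particles to the left only needs generators of \<open>A\<^sub>n\<^sub>-\<^sub>1\<close>, so every nonzero
  submodule of the representation, or of its restriction, contains \<open>v\<^sub>S\<close> for \<open>S = {1..k}\<close>. Over \<open>A\<^sub>n\<close>
  all other basis vectors are reached back from it, which gives irreducibility; over \<open>A\<^sub>n\<^sub>-\<^sub>1\<close> two
  nonzero submodules always intersect, which gives indecomposability. The quotient map deletes the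
  site \<open>n - 1\<close> and kills the sets without it. It annihilates \<open>v\<^sub>S\<close> for \<open>S = {1..k}\<close>, which lies in the image
  of any section, so it does not split.\<close>

section \<open>Finitely supported functions and linear extension\<close>

lemma poly_mapping_single_add_induct [case_names zero single_add]:
  fixes f :: "'a \<Rightarrow>\<^sub>0 'b::comm_monoid_add"
  assumes "P 0" and "\<And>w c f. P f \<Longrightarrow> P (Poly_Mapping.single w c + f)"
  shows "P f"
proof (induction f rule: update_induct)
  case const
  then show ?case using assms(1) by simp
next
  case (update f a b)
  have "Poly_Mapping.update a b f = Poly_Mapping.single a b + f"
    using update(1) by (intro poly_mapping_eqI)
      (auto simp: lookup_update lookup_add lookup_single when_def in_keys_iff)
  then show ?case using assms(2) update by simp
qed

lemma lookup_cscale [simp]: "Poly_Mapping.lookup (cscale c v) S = c * Poly_Mapping.lookup v S"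
  by (simp add: cscale_def map.rep_eq when_def)

lemma cscale_add_right: "cscale c (v + w) = cscale c v + cscale c w"
  by (rule poly_mapping_eqI) (simp add: lookup_add algebra_simps)

lemma cscale_add_left: "cscale (c + d) v = cscale c v + cscale d v"
  by (rule poly_mapping_eqI) (simp add: lookup_add algebra_simps)

lemma cscale_cscale [simp]: "cscale c (cscale d v) = cscale (c * d) v"
  by (rule poly_mapping_eqI) (simp add: algebra_simps)

lemma cscale_simps [simp]: "cscale 0 v = 0" "cscale 1 v = v" "cscale c 0 = 0"
  by (rule poly_mapping_eqI, simp)+

lemma cscale_sum: "cscale c (sum h A) = (\<Sum>a\<in>A. cscale c (h a))"
  by (rule poly_mapping_eqI) (simp add: lookup_sum sum_distrib_left)

lemma lookup_bvec: "Poly_Mapping.lookup (bvec S) T = (if S = T then 1 else 0)"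
  by (simp add: bvec_def lookup_single when_def)

lemma keys_bvec [simp]: "Poly_Mapping.keys (bvec S) = {S}"
  by (simp add: bvec_def)

text \<open>Common form of both actions: \<open>gen_act\<close> extends from sets to vectors,
  \<open>free_act\<close> from words to elements of the free algebra.\<close>

definition lin_ext :: "('a \<Rightarrow> ext_vec) \<Rightarrow> ('a \<Rightarrow>\<^sub>0 complex) \<Rightarrow> ext_vec"
  where "lin_ext b v = (\<Sum>S\<in>Poly_Mapping.keys v. cscale (Poly_Mapping.lookup v S) (b S))"

text \<open>Coordinates outside the support contribute nothing, so vectors with different supports
  can be compared over one index set. The linearity lemmas below rest on this.\<close>

lemma lin_ext_superset:
  assumes "finite A" "Poly_Mapping.keys v \<subseteq> A"
  shows "lin_ext b v = (\<Sum>S\<in>A. cscale (Poly_Mapping.lookup v S) (b S))"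
  unfolding lin_ext_def
  by (rule sum.mono_neutral_left) (use assms in \<open>auto simp: in_keys_iff\<close>)

lemma lin_ext_add: "lin_ext b (v + w) = lin_ext b v + lin_ext b w"
proof -
  let ?A = "Poly_Mapping.keys v \<union> Poly_Mapping.keys w"
  have "Poly_Mapping.keys (v + w) \<subseteq> ?A" by (rule keys_add)
  then show ?thesis
    by (simp add: lin_ext_superset[where A = ?A] lookup_add cscale_add_left sum.distrib)
qed

lemma lin_ext_zero [simp]: "lin_ext b 0 = 0"
  by (simp add: lin_ext_def)

lemma lin_ext_uminus: "lin_ext b (- v) = - lin_ext b v"
  by (metis add.left_inverse add_eq_0_iff lin_ext_add lin_ext_zero)

lemma lin_ext_diff: "lin_ext b (v - w) = lin_ext b v - lin_ext b w"
  by (metis add_diff_cancel diff_add_cancel lin_ext_add)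

lemma lin_ext_cscale: "lin_ext b (cscale c v) = cscale c (lin_ext b v)"
proof -
  have "Poly_Mapping.keys (cscale c v) \<subseteq> Poly_Mapping.keys v" by (auto simp: in_keys_iff)
  then show ?thesis
    by (simp add: lin_ext_superset[where A = "Poly_Mapping.keys v"] cscale_sum)
qed

lemma lin_ext_single [simp]: "lin_ext b (Poly_Mapping.single S c) = cscale c (b S)"
  by (simp add: lin_ext_superset[where A = "{S}"])

lemma lin_ext_bvec [simp]: "lin_ext b (bvec S) = b S"
  by (simp add: bvec_def)

lemma lin_ext_expand: "lin_ext bvec v = v"
  by (rule poly_mapping_eqI)
     (auto simp: lin_ext_def lookup_sum lookup_bvec in_keys_iff if_distrib[of "(*) _"] cong: if_cong)

lemma lookup_lin_ext: "Poly_Mapping.lookup (lin_ext b v) T =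
    (\<Sum>S\<in>Poly_Mapping.keys v. Poly_Mapping.lookup v S * Poly_Mapping.lookup (b S) T)"
  by (simp add: lin_ext_def lookup_sum)

text \<open>Row \<open>T\<close> of the matrix has at most one nonzero entry, in column
  \<open>U\<close>. Such operators are weighted substitutions on coordinates, which is how
  \<open>hop\<close> arises.\<close>

lemma lookup_lin_ext_single_column:
  assumes "\<And>S. Poly_Mapping.lookup (b S) T = (if S = U then c else 0)"
  shows "Poly_Mapping.lookup (lin_ext b v) T = Poly_Mapping.lookup v U * c"
  by (auto simp: lookup_lin_ext assms if_distrib[of "(*) _"] sum.delta in_keys_iff cong: if_cong)

lemma keys_lin_ext:
  "Poly_Mapping.keys (lin_ext b v) \<subseteq> (\<Union>S\<in>Poly_Mapping.keys v. Poly_Mapping.keys (b S))"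
proof
  fix T assume "T \<in> Poly_Mapping.keys (lin_ext b v)"
  then have "(\<Sum>S\<in>Poly_Mapping.keys v. Poly_Mapping.lookup v S * Poly_Mapping.lookup (b S) T) \<noteq> 0"
    by (simp add: in_keys_iff lookup_lin_ext)
  then obtain S where "S \<in> Poly_Mapping.keys v" "Poly_Mapping.lookup (b S) T \<noteq> 0"
    by (auto elim: sum.not_neutral_contains_not_neutral)
  then show "T \<in> (\<Union>S\<in>Poly_Mapping.keys v. Poly_Mapping.keys (b S))"
    by (auto simp: in_keys_iff)
qed

lemma gen_act_eq_lin_ext: "gen_act x = lin_ext (gen_on_basis x)"
  by (simp add: gen_act_def lin_ext_def fun_eq_iff)

lemma free_act_eq_lin_ext: "free_act f v = lin_ext (\<lambda>w. foldr gen_act (letters w) v) f"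
  by (simp add: free_act_def lin_ext_def)

section \<open>The generators as operators on coordinates\<close>

text \<open>A particle hops from \<open>p\<close> to the empty site \<open>i\<close>; in coordinates, the value at \<open>T\<close> is read off
  at the set before the hop. Site \<open>0\<close> counts as an ordinary site, so the defining relations hold
  without restricting the support; only the Jucys--Murphy elements need \<open>0\<close> to be empty.\<close>

definition hop :: "nat \<Rightarrow> nat \<Rightarrow> (nat set \<Rightarrow> complex) \<Rightarrow> nat set \<Rightarrow> complex"
  where "hop i p v T = (if i \<in> T \<and> p \<notin> T then v (insert p (T - {i})) else 0)"

fun gen_op :: "generator \<Rightarrow> (nat set \<Rightarrow> complex) \<Rightarrow> nat set \<Rightarrow> complex"
  where
    "gen_op (Sgen i) v T = (if i \<in> T then - v T else v T) - hop i (i + 1) v T - hop i (i - 1) v T"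
  | "gen_op (Egen i) v T = hop i (i + 1) v T - hop i (i - 1) v T"

text \<open>The forward move of a particle on basis vectors; \<open>hop\<close> is the same operator
  in coordinates.\<close>

definition hop_basis :: "nat \<Rightarrow> nat \<Rightarrow> nat set \<Rightarrow> ext_vec"
  where "hop_basis i p S = (if i \<notin> S \<and> p \<in> S then bvec (S - {p} \<union> {i}) else 0)"

lemma lookup_lin_ext_hop_basis:
  assumes "i \<noteq> p"
  shows "Poly_Mapping.lookup (lin_ext (hop_basis i p) v) T = hop i p (Poly_Mapping.lookup v) T"
proof -
  \<comment> \<open>The move is injective: only the set with the particle put back from
    \<open>i\<close> to \<open>p\<close> can contribute at \<open>T\<close>.\<close>
  have "Poly_Mapping.lookup (hop_basis i p S) T =
      (if S = insert p (T - {i}) then if i \<in> T \<and> p \<notin> T then 1 else 0 else 0)" for S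
    using assms by (auto simp: hop_basis_def lookup_bvec)
  from lookup_lin_ext_single_column[OF this] show ?thesis
    by (simp add: hop_def)
qed

lemma lookup_gen_act:
  assumes "x \<in> gens n"
  shows "Poly_Mapping.lookup (gen_act x v) T = gen_op x (Poly_Mapping.lookup v) T"
proof -
  have split: "lin_ext (\<lambda>S. b S - c S) v = lin_ext b v - lin_ext c v" for b c :: "nat set \<Rightarrow> ext_vec"
    by (rule poly_mapping_eqI) (simp add: lookup_lin_ext lookup_minus algebra_simps sum_subtractf)
  obtain i where i: "i \<ge> 1" and x: "x = Sgen i \<or> x = Egen i"
    using assms by (auto simp: gens_def)
  have S: "gen_on_basis (Sgen i) =
      (\<lambda>S. cscale (if i \<in> S then -1 else 1) (bvec S) - hop_basis i (i + 1) S - hop_basis i (i - 1) S)"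
    by (rule ext, rule poly_mapping_eqI) (auto simp: hop_basis_def lookup_minus)
  have E: "gen_on_basis (Egen i) = (\<lambda>S. hop_basis i (i + 1) S - hop_basis i (i - 1) S)"
    by (rule ext) (auto simp: hop_basis_def)
  have D: "Poly_Mapping.lookup (lin_ext (\<lambda>S. cscale (if i \<in> S then -1 else 1) (bvec S)) v) T =
      Poly_Mapping.lookup v T * (if i \<in> T then -1 else 1)"
    by (rule lookup_lin_ext_single_column) (auto simp: lookup_bvec)
  \<comment> \<open>For \<open>i = 0\<close> the truncated \<open>i - 1\<close> would be
    \<open>i\<close> itself, a hop from a site to itself.\<close>
  have ne: "i \<noteq> i + 1" "i \<noteq> i - 1" using i by auto
  show ?thesis
    using x by (auto simp: gen_act_eq_lin_ext S E split lookup_minus D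
        lookup_lin_ext_hop_basis ne ne[simplified] simp del: gen_on_basis.simps)
qed

lemma lookup_gen_act_pos:
  assumes "1 \<le> i"
  shows "Poly_Mapping.lookup (gen_act (Sgen i) v) = gen_op (Sgen i) (Poly_Mapping.lookup v)"
    and "Poly_Mapping.lookup (gen_act (Egen i) v) = gen_op (Egen i) (Poly_Mapping.lookup v)"
  using assms lookup_gen_act[of _ "Suc i"] by (auto simp: fun_eq_iff gens_def)

text \<open>For distant indices, the target of one hop is neither target nor source of the other, so
  the moves and the signs do not interfere.\<close>

lemma gen_op_commute:
  assumes "1 \<le> i" "1 \<le> j" "i + 1 < j \<or> j + 1 < i"
  shows "gen_op (Sgen i) (gen_op (Sgen j) v) T = gen_op (Sgen j) (gen_op (Sgen i) v) T"
    and "gen_op (Sgen i) (gen_op (Egen j) v) T = gen_op (Egen j) (gen_op (Sgen i) v) T"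
    and "gen_op (Egen i) (gen_op (Egen j) v) T = gen_op (Egen j) (gen_op (Egen i) v) T"
proof -
  have hop_lin: "hop a p (\<lambda>T. f T - g T) T = hop a p f T - hop a p g T" for a p f g T
    by (simp add: hop_def)
  have hop_sgn: "hop a p (\<lambda>T. if c \<in> T then - f T else f T) T = 
     (if c \<in> T then - hop a p f T else hop a p f T)" if "c \<noteq> a" "c \<noteq> p" for a p c f T
    using that by (auto simp: hop_def)
  \<comment> \<open>The sources \<open>p\<close> and \<open>q\<close> may coincide, as they can when
    the indices differ by two. Then both composites vanish, since one particle cannot make both
    hops.\<close>
  have hop_comm: "hop a p (hop b q v) T = hop b q (hop a p v) T"
    if "a \<noteq> b" "a \<noteq> q" "b \<noteq> p" "a \<noteq> p" "b \<noteq> q" for a p b q T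
  proof -
    have "T - {b} - {a} = T - {a} - {b}" by blast
    with that show ?thesis by (auto simp: hop_def insert_commute insert_Diff_if)
  qed
  have ne: "i \<noteq> j" "i \<noteq> j + 1" "i \<noteq> j - 1" "j \<noteq> i + 1" "j \<noteq> i - 1" "i \<noteq> i - 1" "j \<noteq> j - 1"
     "i \<noteq> Suc j" "j \<noteq> Suc i" "i \<noteq> j - Suc 0" "j \<noteq> i - Suc 0" "i \<noteq> i - Suc 0" "j \<noteq> j - Suc 0"
    using assms(1-3) by auto
  have S: "gen_op (Sgen i) = (\<lambda>v T. (if i \<in> T then - v T else v T) - hop i (i + 1) v T - hop i (i - 1) v T)"
     "gen_op (Egen i) = (\<lambda>v T. hop i (i + 1) v T - hop i (i - 1) v T)" for i by (intro ext; simp)+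
  show "gen_op (Sgen i) (gen_op (Sgen j) v) T = gen_op (Sgen j) (gen_op (Sgen i) v) T"
    and "gen_op (Sgen i) (gen_op (Egen j) v) T = gen_op (Egen j) (gen_op (Sgen i) v) T"
    and "gen_op (Egen i) (gen_op (Egen j) v) T = gen_op (Egen j) (gen_op (Egen i) v) T"
    by (simp_all add: S hop_lin hop_sgn ne ne[symmetric] hop_comm)
qed

text \<open>A hop needs site \<open>i\<close> empty and leaves it occupied. On sets containing
  \<open>i\<close>, \<open>s\<^sub>i\<close> acts as -1 and \<open>e\<^sub>i\<close> as 0, so a
  second application only sees the sign or vanishes.\<close>

lemma gen_op_quadratic:
  assumes "1 \<le> i"
  shows "gen_op (Sgen i) (gen_op (Sgen i) v) T = v T"
    and "gen_op (Egen i) (gen_op (Sgen i) v) T = gen_op (Egen i) v T"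
    and "gen_op (Sgen i) (gen_op (Egen i) v) T = - gen_op (Egen i) v T"
    and "gen_op (Egen i) (gen_op (Egen i) v) T = 0"
  using assms by (auto simp: hop_def insert_Diff_if insert_absorb)

lemma gen_op_cubic:
  assumes "1 \<le> i"
  defines "S \<equiv> gen_op (Sgen i)" and "E \<equiv> gen_op (Egen i)"
    and "S' \<equiv> gen_op (Sgen (i + 1))" and "E' \<equiv> gen_op (Egen (i + 1))"
  shows "S (S' (S v)) T = S' (S (S' v)) T"
    and "E' (E (E' v)) T = - E' v T"
    and "E (E' (E v)) T = - E v T"
    and "S (E' (E v)) T = S' (E v) T"
    and "S' (E (E' v)) T = - S (E' v) T"
    and "E' (E (S' v)) T = E' (S v) T"
    and "E (E' (S v)) T = - E (S' v) T"
proof -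
  \<comment> \<open>With \<open>i = Suc p\<close> the generators at \<open>i\<close> and
    \<open>i + 1\<close> involve exactly the sites from \<open>p\<close> to \<open>p + 3\<close>,
    without truncated subtraction; \<open>B\<close> is the occupation elsewhere.\<close>
  obtain p where i: "i = Suc p" using assms(1) by (cases i) auto
  define B where "B = T - {p, Suc p, Suc (Suc p), Suc (Suc (Suc p))}"
  have B: "p \<notin> B" "Suc p \<notin> B" "Suc (Suc p) \<notin> B" "Suc (Suc (Suc p)) \<notin> B"
    by (auto simp: B_def)
  \<comment> \<open>Only the occupation of four sites matters, so each identity is a check of 16 cases.\<close>
  define M where "M = (\<lambda>a b c d. {q. q = p \<and> a \<or> q = Suc p \<and> b \<or> q = Suc (Suc p) \<and> c
      \<or> q = Suc (Suc (Suc p)) \<and> d \<or> q \<in> B})"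
  have mem: "p \<in> M a b c d \<longleftrightarrow> a" "Suc p \<in> M a b c d \<longleftrightarrow> b" "Suc (Suc p) \<in> M a b c d \<longleftrightarrow> c"
      "Suc (Suc (Suc p)) \<in> M a b c d \<longleftrightarrow> d" for a b c d
    using B by (auto simp: M_def)
  have upd: "insert p (M a b c d) = M True b c d" "insert (Suc p) (M a b c d) = M a True c d"
      "insert (Suc (Suc p)) (M a b c d) = M a b True d"
      "insert (Suc (Suc (Suc p))) (M a b c d) = M a b c True"
      "M a b c d - {p} = M False b c d" "M a b c d - {Suc p} = M a False c d"
      "M a b c d - {Suc (Suc p)} = M a b False d"
      "M a b c d - {Suc (Suc (Suc p))} = M a b c False" for a b c d
    using B by (auto simp: M_def)
  have T: "T = M (p \<in> T) (Suc p \<in> T) (Suc (Suc p) \<in> T) (Suc (Suc (Suc p)) \<in> T)"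
    by (auto simp: M_def B_def)
  obtain a b c d where T: "T = M a b c d" using T by blast
  note defs = S_def E_def S'_def E'_def i hop_def T
  show "S (S' (S v)) T = S' (S (S' v)) T"
    by (cases a; cases b; cases c; cases d) (simp_all add: defs mem upd)
  show "E' (E (E' v)) T = - E' v T"
    by (cases a; cases b; cases c; cases d) (simp_all add: defs mem upd)
  show "E (E' (E v)) T = - E v T"
    by (cases a; cases b; cases c; cases d) (simp_all add: defs mem upd)
  show "S (E' (E v)) T = S' (E v) T"
    by (cases a; cases b; cases c; cases d) (simp_all add: defs mem upd)
  show "S' (E (E' v)) T = - S (E' v) T"
    by (cases a; cases b; cases c; cases d) (simp_all add: defs mem upd)
  show "E' (E (S' v)) T = E' (S v) T"
    by (cases a; cases b; cases c; cases d) (simp_all add: defs mem upd)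
  show "E (E' (S v)) T = - E (S' v) T"
    by (cases a; cases b; cases c; cases d) (simp_all add: defs mem upd)
qed

section \<open>The action of the free algebra\<close>

lemma gen_act_linear:
  "gen_act x (v + w) = gen_act x v + gen_act x w"
  "gen_act x (cscale c v) = cscale c (gen_act x v)"
  by (simp_all add: gen_act_eq_lin_ext lin_ext_add lin_ext_cscale)

lemma word_act_linear:
  "foldr gen_act xs (v + w) = foldr gen_act xs v + foldr gen_act xs w"
  "foldr gen_act xs (cscale c v) = cscale c (foldr gen_act xs v)"
  by (induction xs) (simp_all add: gen_act_linear)

lemma free_act_add_left: "free_act (f + g) v = free_act f v + free_act g v"
  by (simp add: free_act_eq_lin_ext lin_ext_add)

lemma free_act_zero_left [simp]: "free_act 0 v = 0"
  by (simp add: free_act_eq_lin_ext)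

lemma free_act_uminus_left: "free_act (- f) v = - free_act f v"
  by (simp add: free_act_eq_lin_ext lin_ext_uminus)

lemma free_act_diff_left: "free_act (f - g) v = free_act f v - free_act g v"
  by (simp add: free_act_eq_lin_ext lin_ext_diff)

lemma free_act_single: "free_act (Poly_Mapping.single w c) v = cscale c (foldr gen_act (letters w) v)"
  by (simp add: free_act_eq_lin_ext)

lemma free_act_scalar [simp]: "free_act (Poly_Mapping.single 0 c) v = cscale c v"
  by (simp add: free_act_single zero_gen_word_def)

lemma free_act_one [simp]: "free_act 1 v = v"
  using free_act_scalar[of 1] by simp

lemma free_act_gens [simp]: "free_act (fs i) = gen_act (Sgen i)" "free_act (fe i) = gen_act (Egen i)"
  by (simp_all add: fun_eq_iff fs_def fe_def free_act_single)

lemma free_act_add_right: "free_act f (v + w) = free_act f v + free_act f w"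
  by (simp add: free_act_def word_act_linear cscale_add_right sum.distrib)

lemma free_act_cscale: "free_act f (cscale c v) = cscale c (free_act f v)"
  by (simp add: free_act_def word_act_linear cscale_sum mult.commute)

lemma free_act_zero_right [simp]: "free_act f 0 = 0"
  using free_act_cscale[of f 0 0] by simp

text \<open>Both sides are additive in \<open>f\<close> and in \<open>g\<close>, so single words
  suffice. Their product concatenates the letters, and \<open>foldr\<close> turns concatenation into
  composition.\<close>

lemma free_act_mult: "free_act (f * g) v = free_act f (free_act g v)"
proof (induction f rule: poly_mapping_single_add_induct)
  case (single_add w c f)
  have "free_act (Poly_Mapping.single w c * g) v = free_act (Poly_Mapping.single w c) (free_act g v)"
  proof (induction g rule: poly_mapping_single_add_induct)
    case (single_add u d g)
    then show ?case
      by (simp add: distrib_left mult_single free_act_add_left free_act_add_right)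
         (simp add: free_act_single plus_gen_word_def word_act_linear)
  qed simp
  with single_add show ?case
    by (simp add: distrib_right free_act_add_left)
qed simp

section \<open>The free algebra and its quotient\<close>

lemma gens_mono: "m \<le> n \<Longrightarrow> gens m \<subseteq> gens n"
  by (auto simp: gens_def)

lemma free_alg_carrier_iff:
  "f \<in> carrier (free_alg n) \<longleftrightarrow> (\<forall>w\<in>Poly_Mapping.keys f. set (letters w) \<subseteq> gens n)"
  by (simp add: free_alg_def)

lemma free_alg_simps [simp]:
  "mult (free_alg n) = (*)" "add (free_alg n) = (+)" "one (free_alg n) = 1" "zero (free_alg n) = 0"
  by (simp_all add: free_alg_def)

lemma free_alg_closed:
  "0 \<in> carrier (free_alg n)" "1 \<in> carrier (free_alg n)"
  "Poly_Mapping.single 0 c \<in> carrier (free_alg n)"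
  "f \<in> carrier (free_alg n) \<Longrightarrow> g \<in> carrier (free_alg n) \<Longrightarrow> f + g \<in> carrier (free_alg n)"
  "f \<in> carrier (free_alg n) \<Longrightarrow> g \<in> carrier (free_alg n) \<Longrightarrow> f * g \<in> carrier (free_alg n)"
  "f \<in> carrier (free_alg n) \<Longrightarrow> - f \<in> carrier (free_alg n)"
  "f \<in> carrier (free_alg n) \<Longrightarrow> g \<in> carrier (free_alg n) \<Longrightarrow> f - g \<in> carrier (free_alg n)"
proof -
  show add: "f + g \<in> carrier (free_alg n)"
    if "f \<in> carrier (free_alg n)" "g \<in> carrier (free_alg n)" for f g
    using that keys_add[of f g] by (auto simp: free_alg_carrier_iff)
  show neg: "- f \<in> carrier (free_alg n)" if "f \<in> carrier (free_alg n)" for f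
    using that by (auto simp: free_alg_carrier_iff in_keys_iff)
  show "f - g \<in> carrier (free_alg n)"
    if "f \<in> carrier (free_alg n)" "g \<in> carrier (free_alg n)"
    using add[OF that(1) neg[OF that(2)]] by simp
  show "f * g \<in> carrier (free_alg n)"
    if "f \<in> carrier (free_alg n)" "g \<in> carrier (free_alg n)"
    using that keys_mult[of f g] by (fastforce simp: free_alg_carrier_iff plus_gen_word_def)
qed (auto simp: free_alg_carrier_iff zero_gen_word_def)

lemma gens_in_free_alg: "i \<in> {1..<n} \<Longrightarrow> fs i \<in> carrier (free_alg n)"
  "i \<in> {1..<n} \<Longrightarrow> fe i \<in> carrier (free_alg n)"
  by (auto simp: free_alg_carrier_iff fs_def fe_def gens_def)

lemma free_alg_mono: "m \<le> n \<Longrightarrow> carrier (free_alg m) \<subseteq> carrier (free_alg n)"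
  using gens_mono by (fastforce simp: free_alg_carrier_iff)

lemma ring_free_alg: "ring (free_alg n)"
proof (rule ringI)
  show "abelian_group (free_alg n)"
  proof (rule abelian_groupI)
    show "\<exists>y\<in>carrier (free_alg n). y \<oplus>\<^bsub>free_alg n\<^esub> x = \<zero>\<^bsub>free_alg n\<^esub>"
      if "x \<in> carrier (free_alg n)" for x
      using that free_alg_closed(6) by (intro bexI[of _ "- x"]) auto
  qed (auto intro: free_alg_closed simp: add_ac)
  show "Group.monoid (free_alg n)"
    by (rule monoidI) (auto intro: free_alg_closed simp: mult.assoc)
qed (auto simp: algebra_simps)

lemma a_inv_free_alg: "f \<in> carrier (free_alg n) \<Longrightarrow> \<ominus>\<^bsub>free_alg n\<^esub> f = - f"
proof -
  interpret ring "free_alg n" by (rule ring_free_alg)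
  show "f \<in> carrier (free_alg n) \<Longrightarrow> \<ominus>\<^bsub>free_alg n\<^esub> f = - f"
    by (rule minus_equality) (auto intro: free_alg_closed)
qed

lemma ideal_free_algI:
  assumes "I \<subseteq> carrier (free_alg n)" "0 \<in> I"
    and "\<And>f g. f \<in> I \<Longrightarrow> g \<in> I \<Longrightarrow> f + g \<in> I"
    and "\<And>f. f \<in> I \<Longrightarrow> - f \<in> I"
    and "\<And>f g. f \<in> I \<Longrightarrow> g \<in> carrier (free_alg n) \<Longrightarrow> f * g \<in> I"
    and "\<And>f g. f \<in> I \<Longrightarrow> g \<in> carrier (free_alg n) \<Longrightarrow> g * f \<in> I"
  shows "ideal I (free_alg n)"
proof (rule idealI)
  show "subgroup I (add_monoid (free_alg n))"
  proof (rule subgroup.intro)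
    show "inv\<^bsub>add_monoid (free_alg n)\<^esub> f \<in> I" if "f \<in> I" for f
      using assms(1,4) a_inv_free_alg[of f n] that by (auto simp: a_inv_def)
  qed (use assms in auto)
qed (use assms ring_free_alg in auto)

lemma relations_in_free_alg: "relations n \<subseteq> carrier (free_alg n)"
  unfolding relations_def by (auto intro!: free_alg_closed gens_in_free_alg)

lemma ideal_rel_ideal: "ideal (rel_ideal n) (free_alg n)"
  unfolding rel_ideal_def by (rule ring.genideal_ideal[OF ring_free_alg relations_in_free_alg])

lemma rel_ideal_closed:
  "0 \<in> rel_ideal n"
  "f \<in> rel_ideal n \<Longrightarrow> g \<in> rel_ideal n \<Longrightarrow> f + g \<in> rel_ideal n"
  "f \<in> rel_ideal n \<Longrightarrow> - f \<in> rel_ideal n"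
  "f \<in> rel_ideal n \<Longrightarrow> g \<in> carrier (free_alg n) \<Longrightarrow> f * g \<in> rel_ideal n"
  "f \<in> rel_ideal n \<Longrightarrow> g \<in> carrier (free_alg n) \<Longrightarrow> g * f \<in> rel_ideal n"
proof -
  interpret I: ideal "rel_ideal n" "free_alg n" by (rule ideal_rel_ideal)
  show "0 \<in> rel_ideal n"
    using additive_subgroup.zero_closed[OF I.additive_subgroup_axioms] by simp
  show "f \<in> rel_ideal n \<Longrightarrow> g \<in> rel_ideal n \<Longrightarrow> f + g \<in> rel_ideal n"
    using additive_subgroup.a_closed[OF I.additive_subgroup_axioms] by simp
  show "f \<in> rel_ideal n \<Longrightarrow> - f \<in> rel_ideal n"
    using I.I_r_closed[of f "- 1"] free_alg_closed by simp
  show "f \<in> rel_ideal n \<Longrightarrow> g \<in> carrier (free_alg n) \<Longrightarrow> f * g \<in> rel_ideal n"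
    using I.I_r_closed by simp
  show "f \<in> rel_ideal n \<Longrightarrow> g \<in> carrier (free_alg n) \<Longrightarrow> g * f \<in> rel_ideal n"
    using I.I_l_closed by simp
qed

text \<open>The coordinates of each relation applied to \<open>v\<close> are exactly the identities
  for \<open>gen_op\<close> proved above.\<close>

lemma free_act_relations:
  assumes "f \<in> relations n"
  shows "free_act f v = 0"
proof -
  note lookups = lookup_gen_act_pos lookup_add lookup_minus
  note defs = free_act_diff_left free_act_add_left free_act_mult
  note rels = gen_op_quadratic gen_op_commute gen_op_cubic[unfolded Suc_eq_plus1[symmetric]]
  show ?thesis
    by (insert assms, unfold relations_def, elim UnE UN_E insertE emptyE;
        rule poly_mapping_eqI;
        auto simp: defs lookups rels simp del: gen_op.simps)
qed

lemma free_act_rel_ideal: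
  assumes "f \<in> rel_ideal n"
  shows "free_act f v = 0"
proof -
  \<comment> \<open>Annihilating all vectors, rather than the given \<open>v\<close> alone, makes
    \<open>?K\<close> closed under right multiplication: \<open>f * g\<close> applies
    \<open>f\<close> to another vector.\<close>
  let ?K = "{f \<in> carrier (free_alg n). \<forall>v. free_act f v = 0}"
  have "ideal ?K (free_alg n)"
    by (rule ideal_free_algI)
       (auto simp: free_act_add_left free_act_uminus_left free_act_mult intro: free_alg_closed)
  moreover have "relations n \<subseteq> ?K"
    using relations_in_free_alg free_act_relations by auto
  ultimately have "rel_ideal n \<subseteq> ?K"
    unfolding rel_ideal_def by (rule ring.genideal_minimal[OF ring_free_alg])
  with assms show ?thesis by blast
qed

lemma ring_pbrauer: "ring (pbrauer n)"
  unfolding pbrauer_def by (rule ideal.quotient_is_ring[OF ideal_rel_ideal])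

lemma quot_class_hom: "quot_class n \<in> Ring.ring_hom (free_alg n) (pbrauer n)"
  using ideal.rcos_ring_hom[OF ideal_rel_ideal, of n] by (simp add: pbrauer_def quot_class_def[abs_def])

lemma quot_class_add:
  "f \<in> carrier (free_alg n) \<Longrightarrow> g \<in> carrier (free_alg n) \<Longrightarrow>
    quot_class n f \<oplus>\<^bsub>pbrauer n\<^esub> quot_class n g = quot_class n (f + g)"
  using ring_hom_add[OF quot_class_hom] by simp

lemma quot_class_mult:
  "f \<in> carrier (free_alg n) \<Longrightarrow> g \<in> carrier (free_alg n) \<Longrightarrow>
    quot_class n f \<otimes>\<^bsub>pbrauer n\<^esub> quot_class n g = quot_class n (f * g)"
  using ring_hom_mult[OF quot_class_hom] by simp

lemma quot_class_one: "\<one>\<^bsub>pbrauer n\<^esub> = quot_class n 1"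
  using ring_hom_one[OF quot_class_hom] by simp

lemma quot_class_zero: "\<zero>\<^bsub>pbrauer n\<^esub> = quot_class n 0"
  using ring_hom_zero[OF quot_class_hom ring_free_alg ring_pbrauer] by simp

lemma quot_class_closed: "f \<in> carrier (free_alg n) \<Longrightarrow> quot_class n f \<in> carrier (pbrauer n)"
  using ring_hom_closed[OF quot_class_hom] .

lemma pbrauer_cases:
  assumes "a \<in> carrier (pbrauer n)"
  obtains f where "f \<in> carrier (free_alg n)" "a = quot_class n f"
  using assms by (auto simp: pbrauer_def FactRing_def A_RCOSETS_def' quot_class_def)

lemma quot_class_eq:
  "quot_class n f = {r + f |r. r \<in> rel_ideal n}"
  by (auto simp: quot_class_def a_r_coset_def' )

text \<open>Representatives of a coset differ by elements acting as zero, so the image is a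
  singleton. This justifies the \<open>the_elem\<close> in \<open>C0\<close>.\<close>

lemma the_elem_free_act_quot_class:
  "the_elem ((\<lambda>f. free_act f v) ` quot_class n f) = free_act f v"
proof -
  have "0 \<in> rel_ideal n"
    by (rule rel_ideal_closed)
  then have "(\<lambda>f. free_act f v) ` quot_class n f = {free_act f v}"
    by (force simp: quot_class_eq free_act_add_left free_act_rel_ideal)
  then show ?thesis by simp
qed

text \<open>The larger ideal, cut down to the smaller free algebra, is an ideal there containing
  \<open>relations m\<close>; minimality of the generated ideal does the rest.\<close>

lemma rel_ideal_mono:
  assumes "m \<le> n"
  shows "rel_ideal m \<subseteq> rel_ideal n"
proof -
  have "carrier (free_alg m) \<subseteq> carrier (free_alg n)"
    using assms by (rule free_alg_mono)
  then have "ideal (rel_ideal n \<inter> carrier (free_alg m)) (free_alg m)"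
    by (intro ideal_free_algI) (auto intro: rel_ideal_closed free_alg_closed)
  moreover have "relations m \<subseteq> relations n"
    using assms unfolding relations_def by (intro Un_mono UN_mono) auto
  then have "relations m \<subseteq> rel_ideal n \<inter> carrier (free_alg m)"
    using relations_in_free_alg ring.genideal_self[OF ring_free_alg relations_in_free_alg, of n]
    by (auto simp: rel_ideal_def)
  ultimately show ?thesis
    unfolding rel_ideal_def[of m] using ring.genideal_minimal[OF ring_free_alg] by blast
qed

text \<open>A coset of the smaller ideal lies inside one coset of the larger, so the
  \<open>the_elem\<close> in \<open>pembed\<close> picks from a singleton.\<close>

lemma pembed_quot_class:
  assumes "m \<le> n" "f \<in> carrier (free_alg m)"
  shows "pembed m n (quot_class m f) = quot_class n f"
proof -
  interpret I: ideal "rel_ideal n" "free_alg n" by (rule ideal_rel_ideal)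
  have f: "f \<in> carrier (free_alg n)" using assms free_alg_mono by blast
  have "quot_class n (r + f) = quot_class n f" if "r \<in> rel_ideal n" for r
  proof -
    have "quot_class n (r + f) = quot_class n r \<oplus>\<^bsub>pbrauer n\<^esub> quot_class n f"
      using that f I.a_subset by (simp add: quot_class_add subset_iff)
    also have "quot_class n r = \<zero>\<^bsub>pbrauer n\<^esub>"
      using that I.a_rcos_const by (simp add: quot_class_def pbrauer_def FactRing_def)
    finally show ?thesis
      using f by (simp add: quot_class_zero quot_class_add free_alg_closed)
  qed
  moreover have "0 \<in> rel_ideal m"
    by (rule rel_ideal_closed)
  ultimately have "quot_class n ` quot_class m f = {quot_class n f}"
    using rel_ideal_mono[OF assms(1)] unfolding quot_class_eq[of m]
    by (auto simp: subset_iff image_iff intro!: exI[of _ 0])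
  then show ?thesis by (simp add: pembed_def)
qed

section \<open>Jucys--Murphy elements\<close>

text \<open>Representatives of the Jucys--Murphy elements in the free algebra. They do not depend on
  \<open>n\<close>, so one eigenvalue computation serves the representation and its
  restriction.\<close>

fun jm_elem :: "nat \<Rightarrow> free_elem"
  where
    "jm_elem 0 = 0"
  | "jm_elem (Suc 0) = 0"
  | "jm_elem (Suc (Suc j)) =
      fs (Suc j) * jm_elem (Suc j) * fs (Suc j) + fs (Suc j) + fe (Suc j)"

lemma jucys_murphy_eq_quot_class:
  "j \<le> n \<Longrightarrow> jm_elem j \<in> carrier (free_alg n) \<and> jucys_murphy n j = quot_class n (jm_elem j)"
proof (induction j rule: jm_elem.induct)
  case (3 j)
  then have "fs (Suc j) \<in> carrier (free_alg n)" "fe (Suc j) \<in> carrier (free_alg n)"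
    by (auto intro: gens_in_free_alg)
  with 3 show ?case
    by (simp add: quot_class_add quot_class_mult free_alg_closed)
qed (simp_all add: quot_class_zero free_alg_closed)

text \<open>The eigenvalue of \<open>Y\<^sub>j\<close> on \<open>v\<^sub>S\<close>: empty sites
  minus occupied sites among those below \<open>j\<close>.\<close>

definition jm_weight :: "nat \<Rightarrow> nat set \<Rightarrow> complex"
  where "jm_weight j S = (\<Sum>i\<in>{1..<j}. if i \<in> S then -1 else 1)"

lemma jm_weight_Suc: "1 \<le> j \<Longrightarrow> jm_weight (Suc j) S = jm_weight j S + (if j \<in> S then -1 else 1)"
  by (simp add: jm_weight_def)

lemma jm_weight_insert [simp]: "j \<le> p \<Longrightarrow> jm_weight j (insert p S) = jm_weight j S"
  and jm_weight_remove [simp]: "j \<le> p \<Longrightarrow> jm_weight j (S - {p}) = jm_weight j S"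
  unfolding jm_weight_def by (auto intro!: sum.cong)

text \<open>The step from weight \<open>i\<close> to weight \<open>i + 1\<close> is -1 or 1
  according to the occupation of \<open>i\<close>. At a site where \<open>S\<close> and
  \<open>T\<close> differ, one of the two weights must therefore differ.\<close>

lemma jm_separates:
  assumes "S \<inter> {1..<n} \<noteq> T \<inter> {1..<n}"
  obtains j where "j \<in> {1..n}" "jm_weight j S \<noteq> jm_weight j T"
proof -
  obtain i where i: "i \<in> {1..<n}" "i \<in> S \<longleftrightarrow> i \<notin> T" using assms by blast
  then have "jm_weight i S \<noteq> jm_weight i T \<or> jm_weight (Suc i) S \<noteq> jm_weight (Suc i) T"
    by (auto simp: jm_weight_Suc)
  with i that[of i] that[of "Suc i"] show ?thesis by auto
qed

text \<open>In \<open>s\<^sub>i + e\<^sub>i\<close> the hops from \<open>i + 1\<close> cancel and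
  those from \<open>i - 1\<close> add up with coefficient -2. Moving a particle from
  \<open>i - 1\<close> to \<open>i\<close> raises the weight of the sites below \<open>i\<close> by
  2, so conjugating that weight by \<open>s\<^sub>i\<close> produces the same hop with coefficient
  2. Only diagonal terms remain.\<close>

lemma lookup_free_act_jm_elem:
  assumes "\<And>T. 0 \<in> T \<Longrightarrow> Poly_Mapping.lookup v T = 0"
  shows "Poly_Mapping.lookup (free_act (jm_elem j) v) T = jm_weight j T * Poly_Mapping.lookup v T"
  using assms
proof (induction j arbitrary: v T rule: jm_elem.induct)
  case (3 j)
  let ?i = "Suc j"
  let ?v = "Poly_Mapping.lookup v"
  define w where "w = gen_act (Sgen ?i) v"
  have w: "Poly_Mapping.lookup w = gen_op (Sgen ?i) ?v"
    by (simp add: w_def lookup_gen_act_pos del: gen_op.simps)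
  \<comment> \<open>Hop targets are at least 1, so site \<open>0\<close> stays empty and the
    induction hypothesis applies to \<open>w\<close>.\<close>
  have "Poly_Mapping.lookup w T = 0" if "0 \<in> T" for T
    using that 3(2) by (auto simp: w hop_def)
  then have "Poly_Mapping.lookup (free_act (jm_elem ?i) w) = (\<lambda>T. jm_weight ?i T * gen_op (Sgen ?i) ?v T)"
    using 3(1)[of w] by (simp add: fun_eq_iff w)
  then have eq: "Poly_Mapping.lookup (free_act (jm_elem (Suc (Suc j))) v) T =
      gen_op (Sgen ?i) (\<lambda>T. jm_weight ?i T * gen_op (Sgen ?i) ?v T) T
      + gen_op (Sgen ?i) ?v T + gen_op (Egen ?i) ?v T"
    by (simp add: free_act_add_left free_act_mult lookup_add lookup_gen_act_pos w_def[symmetric] w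
        del: gen_op.simps)
  show ?case
    unfolding eq using 3(2)
    \<comment> \<open>For \<open>j = 0\<close> the left source is site \<open>0\<close>, and there
      is no weight below to compensate its hop; the support condition removes it.\<close>
    by (cases j) (auto simp: hop_def jm_weight_Suc algebra_simps)
qed (simp_all add: jm_weight_def)

section \<open>Representations spanned by sets of sites\<close>

text \<open>Covers both \<open>C0 n k\<close> and its restriction to \<open>n - 1\<close>. The last assumption says that the
  Jucys--Murphy elements of \<open>pbrauer n\<close> separate \<open>X\<close>.\<close>

locale exterior_rep =
  fixes n :: nat and X :: "nat set set" and M :: "(free_elem set, ext_vec) module"
  assumes carrier_eq: "carrier M = {v. Poly_Mapping.keys v \<subseteq> X}"
    and zero_eq [simp]: "\<zero>\<^bsub>M\<^esub> = 0"
    and add_eq [simp]: "add M = (+)"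
    and smult_quot_class: "\<lbrakk>f \<in> carrier (free_alg n); v \<in> carrier M\<rbrakk> \<Longrightarrow>
      quot_class n f \<odot>\<^bsub>M\<^esub> v = free_act f v"
    and gen_closed: "\<lbrakk>x \<in> gens n; S \<in> X\<rbrakk> \<Longrightarrow> Poly_Mapping.keys (gen_on_basis x S) \<subseteq> X"
    and finite_X: "finite X"
    and zero_site: "S \<in> X \<Longrightarrow> 0 \<notin> S"
    and separated: "inj_on (\<lambda>S. S \<inter> {1..<n}) X"
begin

lemma add_closed: "v \<in> carrier M \<Longrightarrow> w \<in> carrier M \<Longrightarrow> v + w \<in> carrier M"
  using keys_add[of v w] by (auto simp: carrier_eq)

lemma cscale_closed: "v \<in> carrier M \<Longrightarrow> cscale c v \<in> carrier M"
  by (auto simp: carrier_eq in_keys_iff)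

lemma uminus_closed: "v \<in> carrier M \<Longrightarrow> - v \<in> carrier M"
  by (auto simp: carrier_eq in_keys_iff)

lemma bvec_closed: "S \<in> X \<Longrightarrow> bvec S \<in> carrier M"
  by (simp add: carrier_eq)

lemma zero_closed: "0 \<in> carrier M"
  by (simp add: carrier_eq)

lemma free_act_closed:
  assumes "f \<in> carrier (free_alg n)" "v \<in> carrier M"
  shows "free_act f v \<in> carrier M"
proof -
  have gen: "gen_act x u \<in> carrier M" if "x \<in> gens n" "u \<in> carrier M" for x u
    using that gen_closed keys_lin_ext[of "gen_on_basis x" u]
    by (fastforce simp: gen_act_eq_lin_ext carrier_eq)
  have "foldr gen_act xs v \<in> carrier M" if "set xs \<subseteq> gens n" for xs
    using that by (induction xs) (auto intro: gen assms(2))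
  then have "Poly_Mapping.keys (foldr gen_act (letters w) v) \<subseteq> X" if "w \<in> Poly_Mapping.keys f" for w
    using that assms(1) by (auto simp: carrier_eq free_alg_carrier_iff)
  then show ?thesis
    using keys_lin_ext[of "\<lambda>w. foldr gen_act (letters w) v" f]
    by (fastforce simp: carrier_eq free_act_eq_lin_ext)
qed

lemma smult_pscalar: "v \<in> carrier M \<Longrightarrow> pscalar n c \<odot>\<^bsub>M\<^esub> v = cscale c v"
  by (simp add: pscalar_def smult_quot_class free_alg_closed)

lemma abelian_group: "abelian_group M"
proof (rule abelian_groupI)
  show "\<exists>w\<in>carrier M. w \<oplus>\<^bsub>M\<^esub> v = \<zero>\<^bsub>M\<^esub>" if "v \<in> carrier M" for v
    using that uminus_closed by (intro bexI[of _ "- v"]) auto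
qed (auto simp: add_ac intro: add_closed zero_closed)

lemma left_module: "left_module (pbrauer n) M"
proof (intro left_module.intro left_module_axioms.intro ring_pbrauer abelian_group)
  fix a b v w assume v: "v \<in> carrier M" and w: "w \<in> carrier M"
    and a: "a \<in> carrier (pbrauer n)" and b: "b \<in> carrier (pbrauer n)"
  obtain f where f: "f \<in> carrier (free_alg n)" "a = quot_class n f" using a by (rule pbrauer_cases)
  obtain g where g: "g \<in> carrier (free_alg n)" "b = quot_class n g" using b by (rule pbrauer_cases)
  note facts = v w f g smult_quot_class free_act_closed free_alg_closed add_closed
  show "(a \<oplus>\<^bsub>pbrauer n\<^esub> b) \<odot>\<^bsub>M\<^esub> v = a \<odot>\<^bsub>M\<^esub> v \<oplus>\<^bsub>M\<^esub> b \<odot>\<^bsub>M\<^esub> v"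
    by (simp add: facts quot_class_add free_act_add_left)
  show "(a \<otimes>\<^bsub>pbrauer n\<^esub> b) \<odot>\<^bsub>M\<^esub> v = a \<odot>\<^bsub>M\<^esub> (b \<odot>\<^bsub>M\<^esub> v)"
    by (simp add: facts quot_class_mult free_act_mult)
qed (auto elim!: pbrauer_cases simp: smult_quot_class free_act_closed free_alg_closed add_closed
    free_act_add_right quot_class_one)

lemma jucys_murphy_bvec:
  assumes "j \<in> {1..n}" "S \<in> X"
  shows "jucys_murphy n j \<odot>\<^bsub>M\<^esub> bvec S = cscale (jm_weight j S) (bvec S)"
proof -
  have "Poly_Mapping.lookup (bvec S) T = 0" if "0 \<in> T" for T
    using that zero_site[OF assms(2)] by (auto simp: lookup_bvec)
  then have "free_act (jm_elem j) (bvec S) = cscale (jm_weight j S) (bvec S)"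
    by (intro poly_mapping_eqI) (simp add: lookup_free_act_jm_elem lookup_bvec)
  then show ?thesis
    using assms jucys_murphy_eq_quot_class[of j n] by (simp add: smult_quot_class bvec_closed)
qed

lemma complex_space_simps [simp]:
  "carrier (complex_space n M) = carrier M" "add (complex_space n M) = (+)"
  "zero (complex_space n M) = 0" "smult (complex_space n M) c = smult M (pscalar n c)"
  by (simp_all add: complex_space_def restrict_scalars_def)

lemma vectorspace_complex_space: "vectorspace class_ring (complex_space n M)"
proof (rule vectorspace.intro)
  show "module class_ring (complex_space n M)"
  proof (rule moduleI)
    show "cring (class_ring :: complex ring)"
      by (rule class_cring.cring_axioms)
    show "abelian_group (complex_space n M)"
    proof (rule abelian_groupI)
      show "\<exists>w\<in>carrier (complex_space n M). w \<oplus>\<^bsub>complex_space n M\<^esub> v = \<zero>\<^bsub>complex_space n M\<^esub>"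
        if "v \<in> carrier (complex_space n M)" for v
        using that uminus_closed by (intro bexI[of _ "- v"]) auto
    qed (auto simp: add_ac intro: add_closed zero_closed)
  qed (auto simp: smult_pscalar cscale_closed add_closed cscale_add_left cscale_add_right)
  show "field (class_ring :: complex ring)"
    by (rule class_field.field_axioms)
qed

lemma finsum_complex_space:
  assumes "finite A" "h \<in> A \<rightarrow> carrier M"
  shows "finsum (complex_space n M) h A = sum h A"
proof -
  interpret V: vectorspace class_ring "complex_space n M" by (rule vectorspace_complex_space)
  show ?thesis
    using assms by (induction A rule: finite_induct) (simp_all add: Pi_iff)
qed

lemma calibrated: "calibrated n M"
proof -
  interpret V: vectorspace class_ring "complex_space n M" by (rule vectorspace_complex_space)
  have inj: "inj_on bvec X"
    by (auto simp: inj_on_def dest!: arg_cong[where f = Poly_Mapping.keys])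
  have sub: "bvec ` X \<subseteq> carrier M"
    using bvec_closed by blast
  have lincomb: "V.lincomb a (bvec ` A) = (\<Sum>S\<in>A. cscale (a (bvec S)) (bvec S))"
    if A: "A \<subseteq> X" for a A
  proof -
    have "V.lincomb a (bvec ` A) = (\<Sum>v\<in>bvec ` A. pscalar n (a v) \<odot>\<^bsub>M\<^esub> v)"
      unfolding V.lincomb_def using A sub finite_subset[OF A finite_X]
      by (subst finsum_complex_space) (auto simp: smult_pscalar cscale_closed bvec_closed dest: subsetD[OF A])
    also have "\<dots> = (\<Sum>S\<in>A. pscalar n (a (bvec S)) \<odot>\<^bsub>M\<^esub> bvec S)"
      using inj_on_subset[OF inj A] by (simp add: sum.reindex)
    also have "\<dots> = (\<Sum>S\<in>A. cscale (a (bvec S)) (bvec S))"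
      using A by (intro sum.cong) (auto simp: smult_pscalar bvec_closed)
    finally show ?thesis .
  qed
  have coeff: "Poly_Mapping.lookup (\<Sum>S\<in>A. cscale (c S) (bvec S)) T = (if T \<in> A then c T else 0)"
    if "finite A" for A c T
    using that by (simp add: lookup_sum lookup_bvec if_distrib[of "(*) _"] cong: if_cong)
  have "V.basis (bvec ` X)"
    unfolding V.basis_def
  proof (intro conjI)
    show "V.lin_indpt (bvec ` X)"
    proof
      assume "V.lin_dep (bvec ` X)"
      then obtain B a v where B: "B \<subseteq> bvec ` X" "V.lincomb a B = 0" "v \<in> B" "a v \<noteq> 0"
        by (auto simp: V.lin_dep_def)
      then obtain A where A: "A \<subseteq> X" "B = bvec ` A" by (auto simp: subset_image_iff)
      with B(3) obtain S where S: "S \<in> A" "v = bvec S" by blast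
      have "Poly_Mapping.lookup (V.lincomb a B) S = a v"
        using A S finite_subset[OF A(1) finite_X] by (simp add: lincomb coeff)
      with B(2,4) show False by simp
    qed
    show "V.gen_set (bvec ` X)"
    proof
      show "V.span (bvec ` X) \<subseteq> carrier (complex_space n M)"
        using sub V.span_is_subset2 by simp
      show "carrier (complex_space n M) \<subseteq> V.span (bvec ` X)"
      proof
        fix v assume "v \<in> carrier (complex_space n M)"
        then have v: "Poly_Mapping.keys v \<subseteq> X" by (simp add: carrier_eq)
        \<comment> \<open>Coefficients of a linear combination are indexed by vectors, so the set
          labelling a basis vector is recovered through the inverse of \<open>bvec\<close>.\<close>
        define a where "a u = Poly_Mapping.lookup v (the_inv_into X bvec u)" for u
        have "V.lincomb a (bvec ` X) = (\<Sum>S\<in>X. cscale (Poly_Mapping.lookup v S) (bvec S))"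
          by (simp add: lincomb a_def the_inv_into_f_f[OF inj])
        also have "\<dots> = v"
          by (rule poly_mapping_eqI) (use v in \<open>auto simp: coeff finite_X in_keys_iff\<close>)
        finally show "v \<in> V.span (bvec ` X)"
          unfolding V.span_def using finite_X by (auto intro!: exI[of _ a] exI[of _ "bvec ` X"])
      qed
    qed
    show "bvec ` X \<subseteq> carrier (complex_space n M)" using sub by simp
  qed
  moreover have "jucys_murphy n j \<odot>\<^bsub>M\<^esub> bvec S = jm_weight j S \<odot>\<^bsub>complex_space n M\<^esub> bvec S"
    if "j \<in> {1..n}" "S \<in> X" for j S
    using that by (simp add: jucys_murphy_bvec smult_pscalar bvec_closed)
  ultimately show ?thesis
    unfolding calibrated_def using left_module by blast
qed

section \<open>Submodules and basis vectors\<close>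

lemma
  assumes "Module.submodule N (pbrauer n) M"
  shows submodule_subset: "N \<subseteq> carrier M"
    and submodule_add: "v \<in> N \<Longrightarrow> w \<in> N \<Longrightarrow> v + w \<in> N"
    and submodule_zero: "0 \<in> N"
    and submodule_free_act: "f \<in> carrier (free_alg n) \<Longrightarrow> v \<in> N \<Longrightarrow> free_act f v \<in> N"
    and submodule_cscale: "v \<in> N \<Longrightarrow> cscale c v \<in> N"
proof -
  interpret N: Module.submodule N "pbrauer n" M by (rule assms)
  show sub: "N \<subseteq> carrier M" using N.subset by simp
  show "v \<in> N \<Longrightarrow> w \<in> N \<Longrightarrow> v + w \<in> N" using N.m_closed by simp
  show "0 \<in> N" using N.one_closed by simp
  show free: "free_act f v \<in> N" if "f \<in> carrier (free_alg n)" "v \<in> N" for f v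
    using N.smult_closed[OF quot_class_closed that(2)] smult_quot_class that sub by force
  show "cscale c v \<in> N" if "v \<in> N"
    using free[OF free_alg_closed(3) that, of c] by simp
qed

text \<open>If the support has another set \<open>T\<close>, some Jucys--Murphy element separates it
  from \<open>S\<close>. Subtracting its eigenvalue at \<open>T\<close> deletes the coordinate at
  \<open>T\<close>, keeps the one at \<open>S\<close> nonzero and creates none, so the support
  shrinks until only \<open>S\<close> is left.\<close>

lemma submodule_contains_bvec:
  assumes N: "Module.submodule N (pbrauer n) M"
    and "v \<in> N" "S \<in> Poly_Mapping.keys v"
  shows "bvec S \<in> N"
  using assms(2,3)
proof (induction "card (Poly_Mapping.keys v)" arbitrary: v rule: less_induct)
  case less
  have v: "Poly_Mapping.keys v \<subseteq> X" using less(2) submodule_subset[OF N] carrier_eq by blast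
  show ?case
  proof (cases "Poly_Mapping.keys v = {S}")
    case True
    have "bvec S = cscale (1 / Poly_Mapping.lookup v S) v"
      using True by (intro poly_mapping_eqI) (auto simp: lookup_bvec not_in_keys_iff_lookup_eq_zero)
    then show ?thesis using submodule_cscale[OF N less(2)] by metis
  next
    case False
    then obtain T where T: "T \<in> Poly_Mapping.keys v" "T \<noteq> S" using less(3) by blast
    have "S \<in> X" "T \<in> X" using T v less(3) by auto
    then have "S \<inter> {1..<n} \<noteq> T \<inter> {1..<n}"
      using inj_onD[OF separated] T(2) by metis
    then obtain j where j: "j \<in> {1..n}" "jm_weight j S \<noteq> jm_weight j T"
      by (rule jm_separates)
    define w where "w = free_act (jm_elem j) v + cscale (- jm_weight j T) v"
    have "Poly_Mapping.lookup v U = 0" if "0 \<in> U" for U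
      using that v zero_site by (auto simp: in_keys_iff)
    then have w: "Poly_Mapping.lookup w U = (jm_weight j U - jm_weight j T) * Poly_Mapping.lookup v U" for U
      by (simp add: w_def lookup_add lookup_free_act_jm_elem algebra_simps)
    have "w \<in> N"
      unfolding w_def using less(2) j jucys_murphy_eq_quot_class[of j n]
      by (intro submodule_add[OF N] submodule_free_act[OF N] submodule_cscale[OF N]) auto
    moreover have "S \<in> Poly_Mapping.keys w"
      using w less(3) j by (simp add: in_keys_iff)
    moreover have "Poly_Mapping.keys w \<subset> Poly_Mapping.keys v"
      using T w by (auto simp: in_keys_iff psubset_eq)
    ultimately show ?thesis
      using less(1)[OF psubset_card_mono[OF finite_keys]] by simp
  qed
qed

text \<open>The hopped set occurs in \<open>e\<^sub>i\<close> applied to \<open>bvec S\<close>, and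
  a submodule contains every basis vector in the support of its elements.\<close>

lemma submodule_hop:
  assumes N: "Module.submodule N (pbrauer n) M"
    and S: "bvec S \<in> N" and i: "i \<in> {1..<n}" "i \<notin> S" and p: "p \<in> S" "p = i + 1 \<or> i = p + 1"
  shows "bvec (insert i (S - {p})) \<in> N"
proof -
  have "fe i \<in> carrier (free_alg n)" using i by (auto intro: gens_in_free_alg)
  from submodule_free_act[OF N this S] have "gen_act (Egen i) (bvec S) \<in> N" by simp
  moreover have "insert i (S - {p}) \<in> Poly_Mapping.keys (gen_act (Egen i) (bvec S))"
  proof -
    let ?T = "insert i (S - {p})"
    \<comment> \<open>\<open>q\<close> is the other neighbour of \<open>i\<close>. A hop from
      \<open>q\<close> would leave the particle at \<open>p\<close> in place, so it leads to a
      different set and cannot cancel the coefficient.\<close>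
    define q where "q = (if p = i + 1 then i - 1 else i + 1)"
    have "p \<noteq> i" "q \<noteq> p" using i p by (auto simp: q_def)
    then have "insert p (?T - {i}) = S" "p \<notin> insert q (?T - {i})"
      using i p by auto
    then have "hop i p (Poly_Mapping.lookup (bvec S)) ?T = 1"
      and "hop i q (Poly_Mapping.lookup (bvec S)) ?T = 0"
      using i(2) p(1) \<open>p \<noteq> i\<close> by (auto simp: hop_def lookup_bvec)
    then have "gen_op (Egen i) (Poly_Mapping.lookup (bvec S)) ?T \<noteq> 0"
      using p(2) by (auto simp: q_def split: if_splits)
    then show ?thesis
      using i(1) by (simp add: in_keys_iff lookup_gen_act_pos del: gen_op.simps)
  qed
  ultimately show ?thesis by (rule submodule_contains_bvec[OF N])
qed

end

section \<open>Hopping between subsets of fixed size\<close>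

text \<open>Starting from the largest element, the hypothesis fills every positive site below
  it.\<close>

lemma initial_segment_if_no_left_hop:
  fixes S :: "nat set"
  assumes "finite S" "0 \<notin> S" "\<And>i. 1 \<le> i \<Longrightarrow> Suc i \<in> S \<Longrightarrow> i \<in> S"
  shows "S = {1..card S}"
proof (cases "S = {}")
  case False
  define q where "q = Max S"
  have q: "q \<in> S" "\<And>j. j \<in> S \<Longrightarrow> j \<le> q"
    using assms(1) False by (auto simp: q_def)
  have "j \<in> S" if "1 \<le> j" "j \<le> q" for j
    using that(2,1) by (induction rule: inc_induct) (auto intro: q assms(3))
  then have "S = {1..q}"
    using q assms(2) by (auto simp: Suc_le_eq intro!: gr0I)
  then show ?thesis by simp
qed simp

lemma card_hop:
  assumes "finite S" "i \<notin> S" "p \<in> S"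
  shows "card (insert i (S - {p})) = card S"
  using assms card_Suc_Diff1[of S p] by (simp del: card_Diff_singleton)

text \<open>Each left hop lowers the sum of the sites, so the process stops, and it can only stop at
  an initial segment. \<open>P\<close> is arbitrary because both membership in a submodule and
  non-membership will be propagated this way.\<close>

lemma left_hops_reach_initial_segment:
  assumes step: "\<And>S i. \<lbrakk>S \<subseteq> {1..<m}; P S; 1 \<le> i; i \<notin> S; Suc i \<in> S\<rbrakk> \<Longrightarrow> P (insert i (S - {Suc i}))"
    and "S \<subseteq> {1..<m}" "P S"
  shows "P {1..card S}"
  using assms(2,3)
proof (induction "\<Sum>S" arbitrary: S rule: less_induct)
  case less
  have fin: "finite S" using less(2) finite_subset by blast
  show ?case
  proof (cases "S = {1..card S}")
    case True
    with less(3) show ?thesis by simp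
  next
    case False
    then obtain i where i: "1 \<le> i" "Suc i \<in> S" "i \<notin> S"
    proof -
      have "0 \<notin> S" using less(2) by auto
      with False show ?thesis using initial_segment_if_no_left_hop[OF fin] that by blast
    qed
    let ?S' = "insert i (S - {Suc i})"
    have "\<Sum>?S' < \<Sum>S"
      using i fin by (simp add: sum.remove[of S "Suc i"])
    moreover have "?S' \<subseteq> {1..<m}" using i less(2) by auto
    moreover have "P ?S'" using step less i by blast
    ultimately have "P {1..card ?S'}" by (rule less(1))
    moreover have "card ?S' = card S"
      using i fin by (intro card_hop)
    ultimately show ?thesis by simp
  qed
qed

definition ksubsets :: "nat \<Rightarrow> nat \<Rightarrow> nat set set"
  where "ksubsets m k = {S. S \<subseteq> {1..<m} \<and> card S = k}"

lemma finite_ksubsets: "finite (ksubsets m k)"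
  by (rule finite_subset[of _ "Pow {1..<m}"]) (auto simp: ksubsets_def)

lemma ksubsets_hop:
  assumes "S \<in> ksubsets m k" "i \<in> {1..<m}" "i \<notin> S" "p \<in> S"
  shows "insert i (S - {p}) \<in> ksubsets m k"
proof -
  have "finite S" using assms(1) finite_subset by (auto simp: ksubsets_def)
  with assms show ?thesis using card_hop[of S i p] by (auto simp: ksubsets_def)
qed

lemma keys_gen_on_basis_ksubsets:
  assumes "x \<in> gens m" "S \<in> ksubsets m k"
  shows "Poly_Mapping.keys (gen_on_basis x S) \<subseteq> ksubsets m k"
proof -
  obtain i where i: "i \<in> {1..<m}" and x: "x = Sgen i \<or> x = Egen i"
    using assms(1) by (auto simp: gens_def)
  have "T = S \<or> (i \<notin> S \<and> (\<exists>p\<in>S. T = insert i (S - {p})))"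
    if "T \<in> Poly_Mapping.keys (gen_on_basis x S)" for T
    using that x by (auto simp: in_keys_iff lookup_minus lookup_bvec split: if_splits)
  then show ?thesis using assms(2) i ksubsets_hop by blast
qed

text \<open>With the cardinality fixed, the sites below \<open>m\<close> determine whether
  \<open>m\<close> is occupied. Hence the Jucys--Murphy elements of the smaller algebra still
  separate the basis of the restriction.\<close>

lemma ksubsets_Suc_inj_on: "inj_on (\<lambda>S. S \<inter> {1..<m}) (ksubsets (Suc m) k)"
proof (rule inj_onI)
  fix S T assume S: "S \<in> ksubsets (Suc m) k" and T: "T \<in> ksubsets (Suc m) k"
    and eq: "S \<inter> {1..<m} = T \<inter> {1..<m}"
  have split: "U = (U \<inter> {1..<m}) \<union> (if m \<in> U then {m} else {})"
    and card: "k = card (U \<inter> {1..<m}) + (if m \<in> U then 1 else 0)" if "U \<in> ksubsets (Suc m) k" for U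
  proof -
    show *: "U = (U \<inter> {1..<m}) \<union> (if m \<in> U then {m} else {})"
      using that by (auto simp: ksubsets_def subset_iff less_Suc_eq)
    have "card U = card (U \<inter> {1..<m}) + (if m \<in> U then 1 else 0)"
      using arg_cong[OF *, of card] by simp
    then show "k = card (U \<inter> {1..<m}) + (if m \<in> U then 1 else 0)"
      using that by (simp add: ksubsets_def)
  qed
  have "card (T \<inter> {1..<m}) + (if m \<in> S then 1 else 0) = card (T \<inter> {1..<m}) + (if m \<in> T then 1 else 0)"
    using card[OF S] card[OF T] eq by metis
  then have "m \<in> S \<longleftrightarrow> m \<in> T" by (simp split: if_splits)
  with split[OF S] split[OF T] eq show "S = T" by metis
qed

lemma zero_site_ksubsets: "S \<in> ksubsets m k \<Longrightarrow> 0 \<notin> S"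
  by (auto simp: ksubsets_def)

lemma exterior_rep_C0: "exterior_rep n (ksubsets n k) (C0 n k)"
proof
  show "quot_class n f \<odot>\<^bsub>C0 n k\<^esub> v = free_act f v" for f v
    by (simp add: C0_def the_elem_free_act_quot_class)
  show "inj_on (\<lambda>S. S \<inter> {1..<n}) (ksubsets n k)"
    by (auto simp: inj_on_def ksubsets_def Int_absorb2)
  show "carrier (C0 n k) = {v. Poly_Mapping.keys v \<subseteq> ksubsets n k}"
    by (simp add: C0_def ksubsets_def)
qed (simp_all add: C0_def keys_gen_on_basis_ksubsets finite_ksubsets zero_site_ksubsets)

lemma exterior_rep_Res:
  "exterior_rep m (ksubsets (Suc m) k) (Res (Suc m) m (C0 (Suc m) k))"
proof
  show "quot_class m f \<odot>\<^bsub>Res (Suc m) m (C0 (Suc m) k)\<^esub> v = free_act f v"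
    if "f \<in> carrier (free_alg m)" for f v
    using that
    by (simp add: Res_def restrict_scalars_def C0_def pembed_quot_class the_elem_free_act_quot_class)
  show "Poly_Mapping.keys (gen_on_basis x S) \<subseteq> ksubsets (Suc m) k"
    if "x \<in> gens m" "S \<in> ksubsets (Suc m) k" for x S
    using that gens_mono[of m "Suc m"] by (intro keys_gen_on_basis_ksubsets) auto
  show "carrier (Res (Suc m) m (C0 (Suc m) k)) = {v. Poly_Mapping.keys v \<subseteq> ksubsets (Suc m) k}"
    by (simp add: Res_def restrict_scalars_def C0_def ksubsets_def)
qed (simp_all add: Res_def restrict_scalars_def C0_def finite_ksubsets zero_site_ksubsets
    ksubsets_Suc_inj_on[simplified])

section \<open>Irreducibility and indecomposability\<close>

context exterior_rep
begin

lemma submoduleI: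
  assumes "N \<subseteq> carrier M" "0 \<in> N"
    and "\<And>v w. v \<in> N \<Longrightarrow> w \<in> N \<Longrightarrow> v + w \<in> N"
    and "\<And>f v. f \<in> carrier (free_alg n) \<Longrightarrow> v \<in> N \<Longrightarrow> free_act f v \<in> N"
  shows "Module.submodule N (pbrauer n) M"
proof (intro Module.submodule.intro Module.submodule_axioms.intro subgroup.intro)
  show "inv\<^bsub>add_monoid M\<^esub> v \<in> N" if "v \<in> N" for v
  proof -
    have v: "v \<in> carrier M" using that assms(1) by blast
    have "- v = free_act (- 1) v" by (simp add: free_act_uminus_left)
    also have "\<dots> \<in> N" using that by (intro assms(4) free_alg_closed)
    finally have "- v \<in> N" .
    moreover have "\<ominus>\<^bsub>M\<^esub> v = - v"
      by (rule abelian_group.minus_equality[OF abelian_group]) (auto simp: v uminus_closed)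
    ultimately show ?thesis by (simp add: a_inv_def)
  qed
  show "a \<odot>\<^bsub>M\<^esub> v \<in> N" if a: "a \<in> carrier (pbrauer n)" and v: "v \<in> N" for a v
  proof -
    obtain f where "f \<in> carrier (free_alg n)" "a = quot_class n f"
      using a by (rule pbrauer_cases)
    then show ?thesis using v assms(1,4) by (auto simp: smult_quot_class subset_iff)
  qed
qed (use assms in auto)

text \<open>A left hop from \<open>Suc i < m\<close> to \<open>i\<close> uses the generator with
  index \<open>i\<close>, which belongs to the algebra since \<open>m \<le> Suc n\<close> gives
  \<open>i < n\<close>. The case \<open>m = n\<close> serves \<open>C0\<close>, the case
  \<open>m = Suc n\<close> its restriction.\<close>

lemma submodule_contains_initial_segment:
  assumes N: "Module.submodule N (pbrauer n) M" "N \<noteq> {0}"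
    and X: "X = ksubsets m k" "m \<le> Suc n"
  shows "bvec {1..k} \<in> N"
proof -
  obtain v where v: "v \<in> N" "v \<noteq> 0"
    using N submodule_zero[OF N(1)] by blast
  then obtain S where S: "S \<in> Poly_Mapping.keys v" by (auto simp: in_keys_iff poly_mapping_eq_iff fun_eq_iff)
  have "bvec S \<in> N" by (rule submodule_contains_bvec[OF N(1) v(1) S])
  moreover have "S \<in> X" using submodule_subset[OF N(1)] v(1) S by (auto simp: carrier_eq)
  then have S: "S \<subseteq> {1..<m}" "card S = k" by (auto simp: X(1) ksubsets_def)
  ultimately have "bvec {1..card S} \<in> N"
    by (intro left_hops_reach_initial_segment[where P = "\<lambda>S. bvec S \<in> N" and m = m])
       (use X(2) in \<open>auto intro!: submodule_hop[OF N(1)]\<close>)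
  with S show ?thesis by simp
qed

lemma module_homI:
  assumes "exterior_rep n Y L"
    and "\<And>v. v \<in> carrier M \<Longrightarrow> h v \<in> carrier L"
    and "\<And>v w. h (v + w) = h v + h w"
    and "\<And>f v. f \<in> carrier (free_alg n) \<Longrightarrow> h (free_act f v) = free_act f (h v)"
  shows "h \<in> LinearCombinations.module_hom (pbrauer n) M L"
proof -
  interpret L: exterior_rep n Y L by (rule assms(1))
  show ?thesis
    unfolding LinearCombinations.module_hom_def using assms(2-4)
    by (auto elim!: pbrauer_cases simp: smult_quot_class L.smult_quot_class)
qed

end

lemma irreducible_C0:
  assumes "k \<le> n - 1"
  shows "irreducible_mod (pbrauer n) (C0 n k)"
proof -
  interpret exterior_rep n "ksubsets n k" "C0 n k" by (rule exterior_rep_C0)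
  have "{1..k} \<in> ksubsets n k" using assms by (auto simp: ksubsets_def)
  then have "bvec {1..k} \<in> carrier (C0 n k)" by (rule bvec_closed)
  moreover have "bvec {1..k} \<noteq> 0" by (metis keys_bvec keys_zero insert_not_empty)
  moreover have "N = carrier (C0 n k)" if N: "Module.submodule N (pbrauer n) (C0 n k)" "N \<noteq> {0}" for N
  proof
    show "N \<subseteq> carrier (C0 n k)" by (rule submodule_subset[OF N(1)])
    have initial: "bvec {1..k} \<in> N"
      using submodule_contains_initial_segment[OF N] by simp
    have bvec: "bvec S \<in> N" if S: "S \<in> ksubsets n k" for S
    proof (rule ccontr)
      assume "bvec S \<notin> N"
      \<comment> \<open>Contrapositive of the right hop back from \<open>i\<close> to
        \<open>Suc i\<close>. It uses the generator with index \<open>Suc i\<close>, available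
        because \<open>Suc i\<close> is a site below \<open>n\<close>. Non-membership thus travels
        left to the initial segment, a contradiction.\<close>
      moreover have "bvec (insert i (T - {Suc i})) \<notin> N"
        if "T \<subseteq> {1..<n}" "bvec T \<notin> N" "1 \<le> i" "i \<notin> T" "Suc i \<in> T" for T i
      proof
        let ?T = "insert i (T - {Suc i})"
        assume "bvec ?T \<in> N"
        then have "bvec (insert (Suc i) (?T - {i})) \<in> N"
          by (rule submodule_hop[OF N(1)]) (use that in \<open>auto simp: subset_iff\<close>)
        also have "insert (Suc i) (?T - {i}) = T" using that by auto
        finally show False using that by simp
      qed
      ultimately have "bvec {1..card S} \<notin> N"
        using S left_hops_reach_initial_segment[where P = "\<lambda>S. bvec S \<notin> N" and m = n]
        by (auto simp: ksubsets_def)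
      with initial S show False by (simp add: ksubsets_def)
    qed
    show "carrier (C0 n k) \<subseteq> N"
    proof
      fix v assume "v \<in> carrier (C0 n k)"
      then have keys: "Poly_Mapping.keys v \<subseteq> ksubsets n k" by (simp add: carrier_eq)
      have "(\<Sum>S\<in>A. cscale (Poly_Mapping.lookup v S) (bvec S)) \<in> N"
        if "finite A" "A \<subseteq> ksubsets n k" for A
        using that
        by (induction A rule: finite_induct)
           (auto intro: submodule_zero[OF N(1)] submodule_add[OF N(1)] submodule_cscale[OF N(1)] bvec)
      from this[OF finite_keys keys] have "lin_ext bvec v \<in> N" by (simp add: lin_ext_def)
      then show "v \<in> N" by (simp add: lin_ext_expand)
    qed
  qed
  ultimately show ?thesis
    unfolding irreducible_mod_def using left_module by auto
qed

lemma indecomposable_Res_C0: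
  assumes "k \<le> m"
  shows "indecomposable_mod (pbrauer m) (Res (Suc m) m (C0 (Suc m) k))"
proof -
  interpret exterior_rep m "ksubsets (Suc m) k" "Res (Suc m) m (C0 (Suc m) k)"
    by (rule exterior_rep_Res)
  have "{1..k} \<in> ksubsets (Suc m) k" using assms by (auto simp: ksubsets_def)
  then have "bvec {1..k} \<in> carrier (Res (Suc m) m (C0 (Suc m) k))" by (rule bvec_closed)
  moreover have "bvec {1..k} \<noteq> 0" by (metis keys_bvec keys_zero insert_not_empty)
  moreover have "N1 = {0} \<or> N2 = {0}"
    if "Module.submodule N1 (pbrauer m) (Res (Suc m) m (C0 (Suc m) k))"
      "Module.submodule N2 (pbrauer m) (Res (Suc m) m (C0 (Suc m) k))" "N1 \<inter> N2 = {0}" for N1 N2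
  proof (rule ccontr)
    assume "\<not> (N1 = {0} \<or> N2 = {0})"
    then have "bvec {1..k} \<in> N1 \<inter> N2"
      using submodule_contains_initial_segment[OF that(1) _ refl le_refl]
        submodule_contains_initial_segment[OF that(2) _ refl le_refl] by blast
    with that(3) \<open>bvec {1..k} \<noteq> 0\<close> show False by blast
  qed
  ultimately show ?thesis
    unfolding indecomposable_mod_def using left_module by auto
qed

section \<open>The restriction sequence\<close>

text \<open>Here \<open>m\<close> is the largest site, so up to sign this is contraction with the
  coordinate functional of the last basis vector.\<close>

definition drop_site :: "nat \<Rightarrow> ext_vec \<Rightarrow> ext_vec"
  where "drop_site m = lin_ext (\<lambda>S. if m \<in> S then bvec (S - {m}) else 0)"

lemma lookup_drop_site:
  "Poly_Mapping.lookup (drop_site m v) T = (if m \<in> T then 0 else Poly_Mapping.lookup v (insert m T))"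
proof -
  have "Poly_Mapping.lookup (if m \<in> S then bvec (S - {m}) else 0) T =
      (if S = insert m T then if m \<in> T then 0 else 1 else 0)" for S
    by (auto simp: lookup_bvec)
  from lookup_lin_ext_single_column[OF this] show ?thesis by (simp add: drop_site_def)
qed

lemma drop_site_add: "drop_site m (v + w) = drop_site m v + drop_site m w"
  by (simp add: drop_site_def lin_ext_add)

lemma drop_site_zero: "drop_site m 0 = 0"
  by (simp add: drop_site_def)

text \<open>Targets are below \<open>m\<close>, so site \<open>m\<close> is never refilled. A hop
  out of \<open>m\<close> yields a set that \<open>drop_site\<close> kills, and once
  \<open>m\<close> is deleted that hop is impossible.\<close>

lemma drop_site_gen_act:
  assumes "x \<in> gens m"
  shows "drop_site m (gen_act x v) = gen_act x (drop_site m v)"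
proof (rule poly_mapping_eqI)
  fix T
  obtain i where i: "i \<in> {1..<m}" and x: "x = Sgen i \<or> x = Egen i"
    using assms by (auto simp: gens_def)
  show "Poly_Mapping.lookup (drop_site m (gen_act x v)) T = Poly_Mapping.lookup (gen_act x (drop_site m v)) T"
    unfolding lookup_drop_site lookup_gen_act[OF assms]
    using x i by (auto simp: hop_def lookup_drop_site insert_Diff_if insert_commute)
qed

lemma drop_site_free_act:
  assumes "f \<in> carrier (free_alg m)"
  shows "drop_site m (free_act f v) = free_act f (drop_site m v)"
proof -
  have word: "drop_site m (foldr gen_act xs v) = foldr gen_act xs (drop_site m v)"
    if "set xs \<subseteq> gens m" for xs
    using that by (induction xs) (auto simp: drop_site_gen_act)
  have sum: "drop_site m (sum h A) = (\<Sum>a\<in>A. drop_site m (h a))" if "finite A" for h and A :: "gen_word set"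
    using that by (induction A rule: finite_induct) (simp_all add: drop_site_add drop_site_zero)
  have "drop_site m (free_act f v) =
      (\<Sum>w\<in>Poly_Mapping.keys f. cscale (Poly_Mapping.lookup f w) (drop_site m (foldr gen_act (letters w) v)))"
    by (simp add: free_act_def sum) (simp add: drop_site_def lin_ext_cscale)
  also have "\<dots> = free_act f (drop_site m v)"
    unfolding free_act_def using assms by (intro sum.cong) (auto simp: word free_alg_carrier_iff)
  finally show ?thesis .
qed

text \<open>The kernel consists of the vectors supported on sets avoiding \<open>m\<close>, which
  are the basis sets of the left term. The case \<open>m = Suc k\<close>, where that term is zero,
  yields the top exterior power.\<close>

lemma short_exact_drop_site:
  assumes "1 \<le> m"
  shows "short_exact (pbrauer m) (C0 m (Suc k)) (Res (Suc m) m (C0 (Suc m) (Suc k))) (C0 m k)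
    id (drop_site m)"
proof -
  let ?M = "Res (Suc m) m (C0 (Suc m) (Suc k))"
  interpret L: exterior_rep m "ksubsets m (Suc k)" "C0 m (Suc k)" by (rule exterior_rep_C0)
  interpret M: exterior_rep m "ksubsets (Suc m) (Suc k)" ?M by (rule exterior_rep_Res)
  interpret N: exterior_rep m "ksubsets m k" "C0 m k" by (rule exterior_rep_C0)
  have ksub: "ksubsets m (Suc k) = {S \<in> ksubsets (Suc m) (Suc k). m \<notin> S}"
    by (auto simp: ksubsets_def subset_iff less_Suc_eq)
  have drop: "S \<in> ksubsets m k" if "insert m S \<in> ksubsets (Suc m) (Suc k)" "m \<notin> S" for S
  proof -
    have "finite S" using that(1) finite_subset[of "insert m S" "{1..<Suc m}"] by (auto simp: ksubsets_def)
    with that show ?thesis by (auto simp: ksubsets_def subset_iff less_Suc_eq)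
  qed
  have add: "insert m S \<in> ksubsets (Suc m) (Suc k)" "m \<notin> S" if "S \<in> ksubsets m k" for S
  proof -
    show "m \<notin> S" using that by (auto simp: ksubsets_def)
    moreover have "finite S" using that finite_subset by (auto simp: ksubsets_def)
    ultimately show "insert m S \<in> ksubsets (Suc m) (Suc k)"
      using that assms by (auto simp: ksubsets_def)
  qed
  have closed: "drop_site m v \<in> carrier (C0 m k)" if "v \<in> carrier ?M" for v
    using that drop by (auto simp: M.carrier_eq N.carrier_eq in_keys_iff lookup_drop_site split: if_splits)
  have "id \<in> LinearCombinations.module_hom (pbrauer m) (C0 m (Suc k)) ?M"
    by (rule L.module_homI[OF exterior_rep_Res]) (auto simp: L.carrier_eq M.carrier_eq ksub)
  moreover have "drop_site m \<in> LinearCombinations.module_hom (pbrauer m) ?M (C0 m k)"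
    by (rule M.module_homI[OF exterior_rep_C0]) (auto simp: closed drop_site_add drop_site_free_act)
  moreover have "id ` carrier (C0 m (Suc k)) = {v \<in> carrier ?M. drop_site m v = \<zero>\<^bsub>C0 m k\<^esub>}"
  proof -
    have "drop_site m v = 0 \<longleftrightarrow> (\<forall>S\<in>Poly_Mapping.keys v. m \<notin> S)" for v
    proof
      assume "drop_site m v = 0"
      \<comment> \<open>For \<open>S\<close> containing \<open>m\<close>, the coordinate at
        \<open>S - {m}\<close> is that of \<open>v\<close> at \<open>S\<close>.\<close>
      then have "Poly_Mapping.lookup (drop_site m v) (S - {m}) = 0" for S by simp
      then show "\<forall>S\<in>Poly_Mapping.keys v. m \<notin> S"
        by (metis Diff_iff insertI1 insert_Diff lookup_drop_site in_keys_iff)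
    next
      assume "\<forall>S\<in>Poly_Mapping.keys v. m \<notin> S"
      then show "drop_site m v = 0"
        by (intro poly_mapping_eqI) (auto simp: lookup_drop_site in_keys_iff)
    qed
    then show ?thesis by (auto simp: L.carrier_eq M.carrier_eq ksub)
  qed
  moreover have "drop_site m ` carrier ?M = carrier (C0 m k)"
  proof
    show "drop_site m ` carrier ?M \<subseteq> carrier (C0 m k)" using closed by blast
    show "carrier (C0 m k) \<subseteq> drop_site m ` carrier ?M"
    proof
      fix w assume "w \<in> carrier (C0 m k)"
      then have w: "Poly_Mapping.keys w \<subseteq> ksubsets m k" by (simp add: N.carrier_eq)
      \<comment> \<open>A preimage of \<open>w\<close>: fill site \<open>m\<close> in every set.
        This is linear but need not commute with the generators.\<close>
      define v where "v = lin_ext (\<lambda>T. bvec (insert m T)) w"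
      have "Poly_Mapping.keys v \<subseteq> (\<Union>T\<in>Poly_Mapping.keys w. {insert m T})"
        using keys_lin_ext[of "\<lambda>T. bvec (insert m T)" w] by (simp add: v_def)
      then have "v \<in> carrier ?M" using w add by (auto simp: M.carrier_eq)
      moreover have "drop_site m v = w"
      proof (rule poly_mapping_eqI)
        fix T
        have "Poly_Mapping.lookup v (insert m T) = Poly_Mapping.lookup w T" if "m \<notin> T"
        proof -
          have "Poly_Mapping.lookup v (insert m T) =
              (\<Sum>U\<in>Poly_Mapping.keys w. Poly_Mapping.lookup w U * (if U = T then 1 else 0))"
            unfolding v_def lookup_lin_ext
          proof (intro sum.cong refl)
            fix U assume "U \<in> Poly_Mapping.keys w"
            then have "insert m U = insert m T \<longleftrightarrow> U = T"
              using w add(2) that by (intro insert_ident) auto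
            then show "Poly_Mapping.lookup w U * Poly_Mapping.lookup (bvec (insert m U)) (insert m T) =
                Poly_Mapping.lookup w U * (if U = T then 1 else 0)"
              by (simp add: lookup_bvec)
          qed
          then show ?thesis
            by (auto simp: if_distrib[of "(*) _"] in_keys_iff cong: if_cong)
        qed
        moreover have "Poly_Mapping.lookup w T = 0" if "m \<in> T"
          using that w add(2) by (auto simp: in_keys_iff)
        ultimately show "Poly_Mapping.lookup (drop_site m v) T = Poly_Mapping.lookup w T"
          by (simp add: lookup_drop_site)
      qed
      ultimately show "w \<in> drop_site m ` carrier ?M" by blast
    qed
  qed
  ultimately show ?thesis
    unfolding short_exact_def using L.left_module M.left_module N.left_module by simp
qed

lemma not_split_epi_drop_site:
  assumes "Suc k < m"
  shows "\<not> split_epi (pbrauer m) (Res (Suc m) m (C0 (Suc m) (Suc k))) (C0 m k) (drop_site m)"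
proof
  let ?M = "Res (Suc m) m (C0 (Suc m) (Suc k))"
  interpret M: exterior_rep m "ksubsets (Suc m) (Suc k)" ?M by (rule exterior_rep_Res)
  interpret N: exterior_rep m "ksubsets m k" "C0 m k" by (rule exterior_rep_C0)
  assume "split_epi (pbrauer m) ?M (C0 m k) (drop_site m)"
  then obtain s where s: "s \<in> LinearCombinations.module_hom (pbrauer m) (C0 m k) ?M"
    and right_inverse: "\<And>v. v \<in> carrier (C0 m k) \<Longrightarrow> drop_site m (s v) = v"
    by (auto simp: split_epi_def)
  note hom = LinearCombinations.module_hom_closed[OF s] LinearCombinations.module_hom_add[OF s]
    LinearCombinations.module_hom_smult[OF s]
  have s0: "s 0 = 0" using hom(2)[of 0 0] N.zero_closed by simp
  \<comment> \<open>The image of the section is a nonzero submodule, so it must contain the vector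
    of the initial segment.\<close>
  have sub: "Module.submodule (s ` carrier (C0 m k)) (pbrauer m) ?M"
  proof (rule M.submoduleI)
    show "s ` carrier (C0 m k) \<subseteq> carrier ?M" using hom(1) by blast
    show "0 \<in> s ` carrier (C0 m k)" using s0 N.zero_closed by force
    show "v + w \<in> s ` carrier (C0 m k)" if vw: "v \<in> s ` carrier (C0 m k)" "w \<in> s ` carrier (C0 m k)" for v w
    proof -
      obtain x y where "x \<in> carrier (C0 m k)" "v = s x" "y \<in> carrier (C0 m k)" "w = s y"
        using vw by blast
      then show ?thesis using hom(2)[of x y] N.add_closed[of x y] by (metis N.add_eq M.add_eq imageI)
    qed
    show "free_act f v \<in> s ` carrier (C0 m k)"
      if f: "f \<in> carrier (free_alg m)" and v: "v \<in> s ` carrier (C0 m k)" for f v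
    proof -
      obtain w where w: "w \<in> carrier (C0 m k)" "v = s w" using v by blast
      have "s (free_act f w) = free_act f v"
        using hom(3)[OF quot_class_closed[OF f] w(1)] hom(1) w f
        by (simp add: N.smult_quot_class M.smult_quot_class Pi_iff)
      then show ?thesis using N.free_act_closed[OF f w(1)] by (metis imageI)
    qed
  qed
  have "{1..k} \<in> ksubsets m k" using assms by (auto simp: ksubsets_def)
  then have b: "bvec {1..k} \<in> carrier (C0 m k)" by (rule N.bvec_closed)
  have "s (bvec {1..k}) \<noteq> 0"
  proof
    assume "s (bvec {1..k}) = 0"
    then have "bvec {1..k} = 0"
      using right_inverse[OF b] right_inverse[OF N.zero_closed] s0 by simp
    then show False by (metis keys_bvec keys_zero insert_not_empty)
  qed
  then have "s ` carrier (C0 m k) \<noteq> {0}" using b by blast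
  then have "bvec {1..Suc k} \<in> s ` carrier (C0 m k)"
    by (rule M.submodule_contains_initial_segment[OF sub]) auto
  then obtain v where v: "v \<in> carrier (C0 m k)" "s v = bvec {1..Suc k}" by force
  have "v = drop_site m (bvec {1..Suc k})" using right_inverse[OF v(1)] v(2) by simp
  \<comment> \<open>\<open>Suc k < m\<close> keeps site \<open>m\<close> out of
    \<open>{1..Suc k}\<close>.\<close>
  also have "\<dots> = 0" using assms by (simp add: drop_site_def)
  finally have "v = 0" .
  then have "bvec {1..Suc k} = 0" using v(2) s0 by simp
  then show False by (metis keys_bvec keys_zero insert_not_empty)
qed

section \<open>The extremal exterior powers\<close>

lemma isomorphic_Res_C0_0:
  "isomorphic_mod (pbrauer m) (Res (Suc m) m (C0 (Suc m) 0)) (C0 m 0)"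
proof -
  let ?M = "Res (Suc m) m (C0 (Suc m) 0)"
  interpret M: exterior_rep m "ksubsets (Suc m) 0" ?M by (rule exterior_rep_Res)
  interpret N: exterior_rep m "ksubsets m 0" "C0 m 0" by (rule exterior_rep_C0)
  \<comment> \<open>\<open>card\<close> is also 0 on infinite sets; being contained in
    \<open>{1..<l}\<close> leaves only the empty set.\<close>
  have "ksubsets l 0 = {{}}" for l
    using finite_subset by (fastforce simp: ksubsets_def)
  then have carrier: "carrier ?M = carrier (C0 m 0)"
    by (simp add: M.carrier_eq N.carrier_eq)
  then have "id \<in> LinearCombinations.module_hom (pbrauer m) ?M (C0 m 0)"
    by (intro M.module_homI[OF exterior_rep_C0]) auto
  with carrier show ?thesis
    unfolding isomorphic_mod_def using M.left_module N.left_module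
    by (auto intro!: bexI[of _ id])
qed

text \<open>The left term of the exact sequence would need \<open>k + 1\<close> particles on
  \<open>k\<close> sites, so it is zero and \<open>drop_site\<close> is injective.\<close>

lemma isomorphic_Res_C0_top:
  "isomorphic_mod (pbrauer (Suc k)) (Res (Suc (Suc k)) (Suc k) (C0 (Suc (Suc k)) (Suc k))) (C0 (Suc k) k)"
proof -
  let ?m = "Suc k"
  let ?M = "Res (Suc ?m) ?m (C0 (Suc ?m) ?m)"
  interpret L: exterior_rep ?m "ksubsets ?m ?m" "C0 ?m ?m" by (rule exterior_rep_C0)
  interpret M: exterior_rep ?m "ksubsets (Suc ?m) ?m" ?M by (rule exterior_rep_Res)
  interpret N: exterior_rep ?m "ksubsets ?m k" "C0 ?m k" by (rule exterior_rep_C0)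
  have exact: "short_exact (pbrauer ?m) (C0 ?m ?m) ?M (C0 ?m k) id (drop_site ?m)"
    by (rule short_exact_drop_site) simp
  have "S \<notin> ksubsets ?m ?m" for S
  proof
    assume "S \<in> ksubsets ?m ?m"
    then have "S \<subseteq> {1..<?m}" "card S = ?m" by (simp_all add: ksubsets_def)
    with card_mono[of "{1..<?m}" S] show False by simp
  qed
  then have "ksubsets ?m ?m = {}" by blast
  then have "carrier (C0 ?m ?m) = {0}"
    by (auto simp: L.carrier_eq in_keys_iff poly_mapping_eq_iff fun_eq_iff)
  then have kernel: "v = 0" if "v \<in> carrier ?M" "drop_site ?m v = 0" for v
    using exact that by (auto simp: short_exact_def)
  have "inj_on (drop_site ?m) (carrier ?M)"
  proof (rule inj_onI)
    fix v w assume v: "v \<in> carrier ?M" and w: "w \<in> carrier ?M" and eq: "drop_site ?m v = drop_site ?m w"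
    have "v - w = 0"
      by (rule kernel)
         (use M.add_closed[OF v M.uminus_closed[OF w]] eq in \<open>simp_all add: drop_site_def lin_ext_diff\<close>)
    then show "v = w" by simp
  qed
  with exact show ?thesis
    unfolding isomorphic_mod_def short_exact_def bij_betw_def by blast
qed

theorem theorem42:
  fixes n :: nat
  assumes "n \<ge> 2"
  shows
    "(\<forall>k \<le> n - 1. irreducible_mod (pbrauer n) (C0 n k) \<and> calibrated n (C0 n k)) \<and>
     (\<forall>k. 1 \<le> k \<and> k \<le> n - 2 \<longrightarrow>
        indecomposable_mod (pbrauer (n - 1)) (Res n (n - 1) (C0 n k)) \<and>
        calibrated (n - 1) (C0 (n - 1) k) \<and>
        calibrated (n - 1) (Res n (n - 1) (C0 n k)) \<and>
        calibrated (n - 1) (C0 (n - 1) (k - 1)) \<and>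
        (\<exists>f g.
          short_exact (pbrauer (n - 1))
            (C0 (n - 1) k) (Res n (n - 1) (C0 n k)) (C0 (n - 1) (k - 1)) f g \<and>
          \<not> split_epi (pbrauer (n - 1))
            (Res n (n - 1) (C0 n k)) (C0 (n - 1) (k - 1)) g)) \<and>
     isomorphic_mod (pbrauer (n - 1)) (Res n (n - 1) (C0 n 0)) (C0 (n - 1) 0) \<and>
     isomorphic_mod (pbrauer (n - 1)) (Res n (n - 1) (C0 n (n - 1))) (C0 (n - 1) (n - 2))"
proof -
  obtain l where n: "n = Suc (Suc l)"
    using assms by (metis add_2_eq_Suc le_Suc_ex)
  have C0: "calibrated m (C0 m k)" for m k
    by (rule exterior_rep.calibrated[OF exterior_rep_C0])
  have Res: "calibrated m (Res (Suc m) m (C0 (Suc m) k))" for m k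
    by (rule exterior_rep.calibrated[OF exterior_rep_Res])
  have "\<exists>f g. short_exact (pbrauer (Suc l)) (C0 (Suc l) k) (Res n (Suc l) (C0 n k)) (C0 (Suc l) (k - 1)) f g
      \<and> \<not> split_epi (pbrauer (Suc l)) (Res n (Suc l) (C0 n k)) (C0 (Suc l) (k - 1)) g"
    if "1 \<le> k" "k \<le> l" for k
    \<comment> \<open>The sequence was stated with \<open>Suc k\<close>, hence the shift to
      \<open>k - 1\<close>; the non-splitting condition becomes \<open>k < Suc l\<close>.\<close>
    using that short_exact_drop_site[of "Suc l" "k - 1"] not_split_epi_drop_site[of "k - 1" "Suc l"]
    unfolding n by (intro exI[of _ id] exI[of _ "drop_site (Suc l)"]) auto
  then show ?thesis
    using irreducible_C0[of _ n] indecomposable_Res_C0[of _ "Suc l"] C0 Res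
      isomorphic_Res_C0_0[of "Suc l"] isomorphic_Res_C0_top[of l]
    by (simp add: n)
qed

end
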